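(* The following problem is decidable in polynomial time: given two shape graphs $G$ and $H$, decide whether $G\preccurlyeq H$.
   Context: Fix a finite set $\Sigma$ of edge labels. An interval $[n;m]$ with $n\in\mathbb N$, $m\in\mathbb N\cup\{\infty\}$, $n\le m$, denotes $\{i\in\mathbb N: n\le i\le m\}$. Define $[n_1;m_1]\oplus[n_2;m_2]=[n_1+n_2;m_1+m_2]$, the empty $\oplus$-sum being $[0;0]$; $\subseteq$ between intervals is set inclusion. The basic intervals are $[1;1]$, $[0;1]$, $[1;\infty]$, $[0;\infty]$. A graph is a tuple $G=(N_G,E_G,\mathsf{source}_G,\mathsf{target}_G,\mathsf{lab}_G,\mathsf{occur}_G)$ with finite sets $N_G$ of nodes and $E_G$ of edges, $\mathsf{source}_G,\mathsf{target}_G:E_G\to N_G$, $\mathsf{lab}_G:E_G\to\Sigma$, and $\mathsf{occur}_G$ assigning an interval to each edge (multiple parallel edges allowed). A shape graph is a graph all of whose edge intervals are basic. Let $\mathsf{out}_G(n)=\{e\in E_G:\mathsf{source}_G(e)=n\}$. For graphs $G,H$, a relation $R\subseteq N_G\times N_H$ is a simulation if for every $(n,m)\in R$ there is a function $\lambda:\mathsf{out}_G(n)\to\mathsf{out}_H(m)$ such that for every $e\in\mathsf{out}_G(n)$: $\mathsf{lab}_G(e)=\mathsf{lab}_H(\lambda(e))$ and $(\mathsf{target}_G(e),\mathsf{target}_H(\lambda(e)))\in R$; and for every $f\in\mathsf{out}_H(m)$: $\bigoplus\{\mathsf{occur}_G(e): e\in\mathsf{out}_G(n),\lambda(e)=f\}\subseteq\mathsf{occur}_H(f)$.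 An embedding is a simulation whose domain is all of $N_G$; write $G\preccurlyeq H$ if one exists. *)

theory Defs
  imports Main "HOL-Library.Extended_Nat" "HOL-Library.Product_Plus" "HOL-Library.Log_Nat"
    "HOL-Computational_Algebra.Polynomial"
begin

section \<open>Intervals, graphs and embeddings\<close>

text \<open>
  The pair (n, m) stands for the interval [n;m], provided n is at most m. The interval sum is
  the componentwise addition of pairs from Product_Plus, so that the iterated sum of intervals
  is the library's finite sum, with value (0, 0) on the empty set.
\<close>

type_synonym interval = "nat \<times> enat"

definition is_interval :: "interval \<Rightarrow> bool" where
  "is_interval I \<longleftrightarrow> enat (fst I) \<le> snd I"

definition interval_set :: "interval \<Rightarrow> nat set" where
  "interval_set I = {i. fst I \<le> i \<and> enat i \<le> snd I}"

definition basic_intervals :: "interval set" where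
  "basic_intervals = {(1, 1), (0, 1), (1, \<infinity>), (0, \<infinity>)}"

record ('n, 'e, 'l) graph =
  nodes :: "'n set"
  edges :: "'e set"
  source :: "'e \<Rightarrow> 'n"
  target :: "'e \<Rightarrow> 'n"
  lab :: "'e \<Rightarrow> 'l"
  occur :: "'e \<Rightarrow> interval"

definition is_graph :: "'l set \<Rightarrow> ('n, 'e, 'l) graph \<Rightarrow> bool" where
  "is_graph \<Sigma> G \<longleftrightarrow> finite (nodes G) \<and> finite (edges G) \<and>
     (\<forall>e\<in>edges G. source G e \<in> nodes G \<and> target G e \<in> nodes G \<and>
        lab G e \<in> \<Sigma> \<and> is_interval (occur G e))"

definition shape_graph :: "'l set \<Rightarrow> ('n, 'e, 'l) graph \<Rightarrow> bool" where
  "shape_graph \<Sigma> G \<longleftrightarrow> is_graph \<Sigma> G \<and> (\<forall>e\<in>edges G. occur G e \<in> basic_intervals)"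

definition out :: "('n, 'e, 'l) graph \<Rightarrow> 'n \<Rightarrow> 'e set" where
  "out G n = {e \<in> edges G. source G e = n}"

definition simulation ::
  "('n, 'e, 'l) graph \<Rightarrow> ('m, 'f, 'l) graph \<Rightarrow> ('n \<times> 'm) set \<Rightarrow> bool" where
  "simulation G H R \<longleftrightarrow> R \<subseteq> nodes G \<times> nodes H \<and>
     (\<forall>(n, m)\<in>R. \<exists>h. h ` out G n \<subseteq> out H m \<and>
        (\<forall>e\<in>out G n. lab G e = lab H (h e) \<and> (target G e, target H (h e)) \<in> R) \<and>
        (\<forall>f\<in>out H m.
           interval_set (\<Sum>e\<in>{e \<in> out G n. h e = f}. occur G e) \<subseteq> interval_set (occur H f)))"

definition embedding ::
  "('n, 'e, 'l) graph \<Rightarrow> ('m, 'f, 'l) graph \<Rightarrow> ('n \<times> 'm) set \<Rightarrow> bool" where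
  "embedding G H R \<longleftrightarrow> simulation G H R \<and> Domain R = nodes G"

definition embeds :: "('n, 'e, 'l) graph \<Rightarrow> ('m, 'f, 'l) graph \<Rightarrow> bool"
    (infix "\<preceq>" 50) where
  "G \<preceq> H \<longleftrightarrow> (\<exists>R. embedding G H R)"


section \<open>Polynomial time\<close>

text \<open>
  Random access machines in the style of Cook and Reckhow, on natural numbers and with truncated
  subtraction. As in Papadimitriou's textbook, the input is a read-only finite sequence of
  numbers, every instruction takes one time unit, and running times are measured against the
  total bit length of the input. There is no multiplication, so a step lengthens the largest
  number in memory by at most one bit (up to the constants of the program and the numbers of
  the input); hence the languages decided in polynomial time are the same as for Turing
  machines.
\<close>

datatype instr =
    Const nat nat     \<comment> \<open>\<open>X\<^sub>i := c\<close>\<close>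
  | Add nat nat nat   \<comment> \<open>\<open>X\<^sub>i := X\<^sub>j + X\<^sub>k\<close>\<close>
  | Sub nat nat nat   \<comment> \<open>\<open>X\<^sub>i := X\<^sub>j - X\<^sub>k\<close>\<close>
  | Load nat nat      \<comment> \<open>\<open>X\<^sub>i := X\<^bsub>a\<^esub>\<close> where \<open>a = X\<^sub>j\<close>\<close>
  | Store nat nat     \<comment> \<open>\<open>X\<^bsub>a\<^esub> := X\<^sub>j\<close> where \<open>a = X\<^sub>i\<close>\<close>
  | Read nat nat      \<comment> \<open>\<open>X\<^sub>i :=\<close> input number at position \<open>X\<^sub>j\<close> (from 0), or 0 beyond the end\<close>
  | JumpPos nat nat   \<comment> \<open>if \<open>X\<^sub>i > 0\<close>, continue at the given instruction\<close>

type_synonym program = "instr list"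
type_synonym memory = "nat \<Rightarrow> nat"
type_synonym config = "nat \<times> memory"  \<comment> \<open>program counter and memory\<close>

fun exec :: "nat list \<Rightarrow> instr \<Rightarrow> config \<Rightarrow> config" where
  "exec x (Const i c) (pc, X) = (Suc pc, X(i := c))"
| "exec x (Add i j k) (pc, X) = (Suc pc, X(i := X j + X k))"
| "exec x (Sub i j k) (pc, X) = (Suc pc, X(i := X j - X k))"
| "exec x (Load i j) (pc, X) = (Suc pc, X(i := X (X j)))"
| "exec x (Store i j) (pc, X) = (Suc pc, X(X i := X j))"
| "exec x (Read i j) (pc, X) = (Suc pc, X(i := (if X j < length x then x ! X j else 0)))"
| "exec x (JumpPos i l) (pc, X) = (if X i > 0 then l else Suc pc, X)"

definition halted :: "program \<Rightarrow> config \<Rightarrow> bool" where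
  "halted P c \<longleftrightarrow> fst c \<ge> length P"

definition step :: "program \<Rightarrow> nat list \<Rightarrow> config \<Rightarrow> config" where
  "step P x c = (if halted P c then c else exec x (P ! fst c) c)"

definition init :: "nat list \<Rightarrow> config" where
  "init x = (0, (\<lambda>_. 0)(0 := length x))"

text \<open>Since halted configurations are fixed by \<open>step\<close>, the output below is that of the
  configuration in which the machine stops.\<close>

definition decides_within ::
  "program \<Rightarrow> nat list set \<Rightarrow> (nat list \<Rightarrow> nat) \<Rightarrow> bool" where
  "decides_within P L T \<longleftrightarrow>
     (\<forall>x. \<exists>t \<le> T x. let c = (step P x ^^ t) (init x) in
        halted P c \<and> snd c 0 = (if x \<in> L then 1 else 0))"

text \<open>One additional unit per number accounts for a separator; in particular a 0 is not for
  free, although \<open>floorlog 2 0 = 0\<close>.\<close>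

definition bit_size :: "nat list \<Rightarrow> nat" where
  "bit_size x = (\<Sum>a\<leftarrow>x. floorlog 2 a + 1)"

definition poly_time_decidable :: "nat list set \<Rightarrow> bool" where
  "poly_time_decidable L \<longleftrightarrow>
     (\<exists>P. \<exists>p :: nat poly. decides_within P L (\<lambda>x. poly p (bit_size x)))"


section \<open>The embedding problem for shape graphs\<close>

text \<open>
  For the input, nodes and edges are taken to be natural numbers, which is no restriction as
  they are finite in number. A graph is written as the list of its nodes followed by the list
  of its edges, each list being preceded by its length; the order of both lists is arbitrary.
  The function \<open>\<kappa>\<close> numbers the labels; an infinite upper bound is written as 0 and a
  finite one as its successor.
\<close>

fun encode_interval :: "interval \<Rightarrow> nat list" where
  "encode_interval (n, m) = [n, case m of enat k \<Rightarrow> Suc k | \<infinity> \<Rightarrow> 0]"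

definition encode_edge :: "('l \<Rightarrow> nat) \<Rightarrow> (nat, 'e, 'l) graph \<Rightarrow> 'e \<Rightarrow> nat list" where
  "encode_edge \<kappa> G e =
     [source G e, target G e, \<kappa> (lab G e)] @ encode_interval (occur G e)"

definition encodes :: "('l \<Rightarrow> nat) \<Rightarrow> nat list \<Rightarrow> (nat, 'e, 'l) graph \<Rightarrow> bool" where
  "encodes \<kappa> w G \<longleftrightarrow> (\<exists>ns es.
     distinct ns \<and> set ns = nodes G \<and> distinct es \<and> set es = edges G \<and>
     w = length ns # ns @ length es # concat (map (encode_edge \<kappa> G) es))"

definition shape_embedding_problem :: "'l set \<Rightarrow> ('l \<Rightarrow> nat) \<Rightarrow> nat list set" where
  "shape_embedding_problem \<Sigma> \<kappa> =
     {v @ w | v w (G :: (nat, nat, 'l) graph) (H :: (nat, nat, 'l) graph).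
        shape_graph \<Sigma> G \<and> shape_graph \<Sigma> H \<and> encodes \<kappa> v G \<and> encodes \<kappa> w H \<and> G \<preceq> H}"

end

theory Submission imports Defs begin

text \<open>
  The largest simulation is obtained from the relation of all pairs of nodes by removing pairs
  that violate the local condition. For basic intervals, a suitable function between the outgoing
  edges exists iff some matching covers the source edges that cannot go to an edge of unbounded
  multiplicity as well as the mandatory target edges. By the theorem of Mendelsohn and Dulmage it
  suffices to cover these two sets separately, which an auction algorithm decides: its failure
  yields a violation of Hall's condition.

  All loops of this algorithm can be bounded by the length of the input. It is written in a small
  language in which every loop has this bound, so that a polynomial running time of the compiled
  program can be read off from the syntax.
\<close>

section \<open>A loop language\<close>

text \<open>Basic intervals have lower bound 0 or 1 and upper bound 1 or infinity. So a target edge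
  with upper bound 1 takes at most one source edge, one with lower bound 1 needs some source edge
  with lower bound 1, and one with infinite upper bound takes any number. This turns a condition on
  sums of intervals into bipartite matching. The obstacle is that prescribed vertices on both sides
  have to be matched at once, whereas an auction serves the bidders of one side only; hence two
  auctions with exchanged roles, whose results are merged only in the correctness proof. An auction
  suits the loop language better than augmenting paths: its state is two arrays, a move looks at one
  bidder and one item, and each move raises the sum of the prices. Neither the auction nor the
  refinement tests for termination. With \<open>N\<close> the length of the input, their potentials
  are at most \<open>N * (N + 1)\<close> and \<open>N * N\<close>, so \<open>N * N * N\<close>
  sweeps reach a fixed point. Loop bounds never depend on the numbers in the input, only on its
  length, so large numbers naming nodes do no harm.\<close>

datatype expr =
    Num nat
  | Len
  | Var nat
  | Inp expr
  | Arr nat expr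
  | Plus expr expr
  | Minus expr expr
  | Ite expr expr expr
  | Bsum nat expr

datatype cmd =
    Put nat expr expr
  | Seq cmd cmd
  | IfC expr cmd
  | For nat cmd

type_synonym env = "nat \<Rightarrow> nat"
type_synonym heap = "nat \<Rightarrow> nat \<Rightarrow> nat"

text \<open>The default 0 is that of the instruction \<open>Read\<close>. It makes evaluation total,
  so that the program also runs on malformed inputs.\<close>

definition input_at :: "nat list \<Rightarrow> nat \<Rightarrow> nat" where
  "input_at x k = (if k < length x then x ! k else 0)"

text \<open>\<open>Bsum\<close> is the only binder. A sum of natural numbers is positive iff some
  summand is, so it serves as a bounded quantifier and, with a constant summand, as multiplication
  by the length of the input.\<close>

primrec eval :: "nat list \<Rightarrow> heap \<Rightarrow> env \<Rightarrow> expr \<Rightarrow> nat" where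
  "eval x h s (Num c) = c"
| "eval x h s Len = length x"
| "eval x h s (Var v) = s v"
| "eval x h s (Inp e) = input_at x (eval x h s e)"
| "eval x h s (Arr a e) = h a (eval x h s e)"
| "eval x h s (Plus e1 e2) = eval x h s e1 + eval x h s e2"
| "eval x h s (Minus e1 e2) = eval x h s e1 - eval x h s e2"
| "eval x h s (Ite e e1 e2) = (if eval x h s e > 0 then eval x h s e1 else eval x h s e2)"
| "eval x h s (Bsum v e) = (\<Sum>k<length x. eval x h (s(v := k)) e)"

definition put :: "nat \<Rightarrow> nat \<Rightarrow> nat \<Rightarrow> heap \<Rightarrow> heap" where
  "put a i c h = h(a := (h a)(i := c))"

text \<open>Commands change the heap but not the environment. A loop body thus cannot touch its
  counter, and every \<open>For\<close> makes exactly \<open>length x\<close> rounds.\<close>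

primrec run :: "nat list \<Rightarrow> env \<Rightarrow> cmd \<Rightarrow> heap \<Rightarrow> heap" where
  "run x s (Put a e1 e2) = (\<lambda>h. put a (eval x h s e1) (eval x h s e2) h)"
| "run x s (Seq c1 c2) = (\<lambda>h. run x s c2 (run x s c1 h))"
| "run x s (IfC e c) = (\<lambda>h. if eval x h s e > 0 then run x s c h else h)"
| "run x s (For v c) = fold (\<lambda>k. run x (s(v := k)) c) [0..<length x]"

text \<open>The bound 4 is the number of arrays interleaved in memory. As it is a power of two,
  addresses can be computed by doubling twice.\<close>

primrec expr_wf :: "expr \<Rightarrow> bool" where
  "expr_wf (Num c) = True"
| "expr_wf Len = True"
| "expr_wf (Var v) = True"
| "expr_wf (Inp e) = expr_wf e"
| "expr_wf (Arr a e) = (a < 4 \<and> expr_wf e)"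
| "expr_wf (Plus e1 e2) = (expr_wf e1 \<and> expr_wf e2)"
| "expr_wf (Minus e1 e2) = (expr_wf e1 \<and> expr_wf e2)"
| "expr_wf (Ite e e1 e2) = (expr_wf e \<and> expr_wf e1 \<and> expr_wf e2)"
| "expr_wf (Bsum v e) = expr_wf e"

primrec cmd_wf :: "cmd \<Rightarrow> bool" where
  "cmd_wf (Put a e1 e2) = (a < 4 \<and> expr_wf e1 \<and> expr_wf e2)"
| "cmd_wf (Seq c1 c2) = (cmd_wf c1 \<and> cmd_wf c2)"
| "cmd_wf (IfC e c) = (expr_wf e \<and> cmd_wf c)"
| "cmd_wf (For v c) = cmd_wf c"

text \<open>A generous upper bound on the scratch registers from \<open>d\<close> upwards; it
  determines where the arrays may start.\<close>

primrec expr_regs :: "expr \<Rightarrow> nat" where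
  "expr_regs (Num c) = 1"
| "expr_regs Len = 1"
| "expr_regs (Var v) = 1"
| "expr_regs (Inp e) = expr_regs e"
| "expr_regs (Arr a e) = expr_regs e + 2"
| "expr_regs (Plus e1 e2) = expr_regs e1 + expr_regs e2 + 1"
| "expr_regs (Minus e1 e2) = expr_regs e1 + expr_regs e2 + 1"
| "expr_regs (Ite e e1 e2) = expr_regs e + expr_regs e1 + expr_regs e2"
| "expr_regs (Bsum v e) = expr_regs e + 3"

primrec cmd_regs :: "cmd \<Rightarrow> nat" where
  "cmd_regs (Put a e1 e2) = expr_regs e1 + expr_regs e2 + 2"
| "cmd_regs (Seq c1 c2) = cmd_regs c1 + cmd_regs c2"
| "cmd_regs (IfC e c) = expr_regs e + cmd_regs c"
| "cmd_regs (For v c) = cmd_regs c + 2"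

text \<open>The polynomial \<open>[:0, 1:]\<close> is the indeterminate, standing for the length of
  the input. A round of \<open>Bsum\<close> costs five instructions besides its body; initialisation
  and the last, failing test cost another five. For the loops in \<open>cmd_time\<close> both
  numbers are four.\<close>

primrec expr_time :: "expr \<Rightarrow> nat poly" where
  "expr_time (Num c) = [:1:]"
| "expr_time Len = [:2:]"
| "expr_time (Var v) = [:2:]"
| "expr_time (Inp e) = expr_time e + [:1:]"
| "expr_time (Arr a e) = expr_time e + [:5:]"
| "expr_time (Plus e1 e2) = expr_time e1 + expr_time e2 + [:1:]"
| "expr_time (Minus e1 e2) = expr_time e1 + expr_time e2 + [:1:]"
| "expr_time (Ite e e1 e2) = expr_time e + expr_time e1 + expr_time e2 + [:2:]"
| "expr_time (Bsum v e) = [:0, 1:] * (expr_time e + [:5:]) + [:5:]"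

primrec cmd_time :: "cmd \<Rightarrow> nat poly" where
  "cmd_time (Put a e1 e2) = expr_time e1 + expr_time e2 + [:5:]"
| "cmd_time (Seq c1 c2) = cmd_time c1 + cmd_time c2"
| "cmd_time (IfC e c) = expr_time e + cmd_time c + [:2:]"
| "cmd_time (For v c) = [:0, 1:] * (cmd_time c + [:4:]) + [:4:]"

section \<open>Compilation\<close>

text \<open>
  Register 0 holds 1 and register 1 holds the length of the input. The code for an expression
  only writes registers from \<open>d\<close> up to \<open>B\<close> and leaves the value in register \<open>d\<close>; \<open>r\<close> maps the
  bound variables to registers below \<open>d\<close>. Entry \<open>i\<close> of array \<open>a\<close> has the address \<open>B + 4 * i + a\<close>.
\<close>

primrec compile_expr :: "nat \<Rightarrow> (nat \<Rightarrow> nat) \<Rightarrow> nat \<Rightarrow> nat \<Rightarrow> expr \<Rightarrow> instr list" where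
  "compile_expr B r d p (Num c) = [Const d c]"
| "compile_expr B r d p Len = [Const d 0, Add d d 1]"
| "compile_expr B r d p (Var v) = [Const d 0, Add d d (r v)]"
| "compile_expr B r d p (Inp e) = compile_expr B r d p e @ [Read d d]"
| "compile_expr B r d p (Arr a e) = compile_expr B r d p e @
     [Add d d d, Add d d d, Const (d + 1) (B + a), Add d d (d + 1), Load d d]"
| "compile_expr B r d p (Plus e1 e2) =
     (let c1 = compile_expr B r d p e1; c2 = compile_expr B r (d + 1) (p + length c1) e2
      in c1 @ c2 @ [Add d d (d + 1)])"
| "compile_expr B r d p (Minus e1 e2) =
     (let c1 = compile_expr B r d p e1; c2 = compile_expr B r (d + 1) (p + length c1) e2
      in c1 @ c2 @ [Sub d d (d + 1)])"
| "compile_expr B r d p (Ite e e1 e2) =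
     (let c = compile_expr B r d p e;
          c2 = compile_expr B r d (p + length c + 1) e2;
          q = p + length c + length c2 + 2;
          c1 = compile_expr B r d q e1
      in c @ [JumpPos d q] @ c2 @ [JumpPos 0 (q + length c1)] @ c1)"
| "compile_expr B r d p (Bsum v e) =
     (let c = compile_expr B (r(v := d + 1)) (d + 2) (p + 5) e
      in [Const d 0, Const (d + 1) 0, Sub (d + 2) 1 (d + 1), JumpPos (d + 2) (p + 5),
          JumpPos 0 (p + length c + 8)] @ c @
         [Add d d (d + 2), Add (d + 1) (d + 1) 0, JumpPos 0 (p + 2)])"

text \<open>Jump targets are absolute, hence the parameter \<open>p\<close> for the address of the
  code. \<open>JumpPos 0\<close> always jumps, since register 0 holds 1. A loop continues as long as
  the truncated difference of length and counter is positive.\<close>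

primrec compile_cmd :: "nat \<Rightarrow> (nat \<Rightarrow> nat) \<Rightarrow> nat \<Rightarrow> nat \<Rightarrow> cmd \<Rightarrow> instr list" where
  "compile_cmd B r d p (Put a e1 e2) =
     (let c1 = compile_expr B r d p e1; c2 = compile_expr B r (d + 1) (p + length c1 + 4) e2
      in c1 @ [Add d d d, Add d d d, Const (d + 1) (B + a), Add d d (d + 1)] @ c2 @
         [Store d (d + 1)])"
| "compile_cmd B r d p (Seq c1 c2) =
     (let l1 = compile_cmd B r d p c1 in l1 @ compile_cmd B r d (p + length l1) c2)"
| "compile_cmd B r d p (IfC e c) =
     (let l1 = compile_expr B r d p e; l2 = compile_cmd B r d (p + length l1 + 2) c
      in l1 @ [JumpPos d (p + length l1 + 2), JumpPos 0 (p + length l1 + 2 + length l2)] @ l2)"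
| "compile_cmd B r d p (For v c) =
     (let l = compile_cmd B (r(v := d)) (d + 1) (p + 4) c
      in [Const d 0, Sub (d + 1) 1 d, JumpPos (d + 1) (p + 4), JumpPos 0 (p + length l + 6)] @
         l @ [Add d d 0, JumpPos 0 (p + 1)])"

definition code_at :: "program \<Rightarrow> nat \<Rightarrow> instr list \<Rightarrow> bool" where
  "code_at P p is \<longleftrightarrow> (\<forall>k<length is. p + k < length P \<and> P ! (p + k) = is ! k)"

lemma code_at_Nil [simp]: "code_at P p []"
  by (simp add: code_at_def)

lemma code_at_Cons [simp]:
  "code_at P p (i # is) \<longleftrightarrow> p < length P \<and> P ! p = i \<and> code_at P (Suc p) is"
  by (auto simp: code_at_def nth_Cons' less_Suc_eq_0_disj)

lemma code_at_append [simp]: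
  "code_at P p (is @ js) \<longleftrightarrow> code_at P p is \<and> code_at P (p + length is) js"
  by (induction "is" arbitrary: p) auto

section \<open>Timed executions and correctness of the compiler\<close>

definition reaches :: "program \<Rightarrow> nat list \<Rightarrow> nat \<Rightarrow> config \<Rightarrow> config \<Rightarrow> bool" where
  "reaches P x T c c' \<longleftrightarrow> (\<exists>t\<le>T. (step P x ^^ t) c = c')"

lemma reaches_refl: "reaches P x T c c"
  unfolding reaches_def by (rule exI[of _ 0]) simp

lemma reaches_trans:
  assumes "reaches P x T1 c1 c2" "reaches P x T2 c2 c3" "T1 + T2 \<le> T"
  shows "reaches P x T c1 c3"
proof -
  obtain t1 t2 where "t1 \<le> T1" "(step P x ^^ t1) c1 = c2" "t2 \<le> T2" "(step P x ^^ t2) c2 = c3"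
    using assms by (auto simp: reaches_def)
  then show ?thesis
    unfolding reaches_def using assms(3)
    by (intro exI[of _ "t2 + t1"]) (simp add: funpow_add)
qed

lemma reaches_step:
  assumes "p < length P" "P ! p = i" "reaches P x T (exec x i (p, m)) c"
  shows "reaches P x (Suc T) (p, m) c"
proof -
  have "step P x (p, m) = exec x i (p, m)"
    using assms by (simp add: step_def halted_def)
  then have "reaches P x 1 (p, m) (exec x i (p, m))"
    unfolding reaches_def by (intro exI[of _ 1]) simp
  from reaches_trans[OF this assms(3)] show ?thesis by simp
qed

lemma reaches_mono: "reaches P x T c c' \<Longrightarrow> T \<le> T' \<Longrightarrow> reaches P x T' c c'"
  unfolding reaches_def using le_trans by blast

text \<open>Every variable must live in some register, even an unbound one: at the start all of them
  share register 1 and so denote the length of the input. The condition \<open>2 \<le> d\<close>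
  protects registers 0 and 1 from the compiled code.\<close>

definition consistent ::
  "nat \<Rightarrow> nat list \<Rightarrow> (nat \<Rightarrow> nat) \<Rightarrow> nat \<Rightarrow> heap \<Rightarrow> env \<Rightarrow> memory \<Rightarrow> bool" where
  "consistent B x r d h s m \<longleftrightarrow> 2 \<le> d \<and> m 0 = 1 \<and> m 1 = length x \<and>
     (\<forall>v. r v < d \<and> m (r v) = s v) \<and> (\<forall>a<4. \<forall>i. m (B + 4 * i + a) = h a i)"

definition agree :: "nat \<Rightarrow> nat \<Rightarrow> memory \<Rightarrow> memory \<Rightarrow> bool" where
  "agree B d m m' \<longleftrightarrow> (\<forall>k. k < d \<or> B \<le> k \<longrightarrow> m' k = m k)"

lemma consistent_agree:
  assumes "consistent B x r d h s m" "agree B d m m'"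
  shows "consistent B x r d h s m'"
  using assms by (auto simp: consistent_def agree_def)

lemma consistent_Suc: "consistent B x r d h s m \<Longrightarrow> consistent B x r (Suc d) h s m"
  by (auto simp: consistent_def less_Suc_eq)

lemma expr_regs_pos: "0 < expr_regs e"
  by (induction e) auto

text \<open>A Hoare triple for total correctness with a bound on the number of steps.\<close>

definition leads_to ::
  "program \<Rightarrow> nat list \<Rightarrow> nat \<Rightarrow> nat \<Rightarrow> nat \<Rightarrow> memory \<Rightarrow> (memory \<Rightarrow> bool) \<Rightarrow> bool" where
  "leads_to P x T p q m Q \<longleftrightarrow> (\<exists>m'. reaches P x T (p, m) (q, m') \<and> Q m')"

lemma leads_toI:
  assumes "reaches P x T' (p, m) (q', m')" "T' \<le> T" "q' = q" "Q m'"
  shows "leads_to P x T p q m Q"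
  unfolding leads_to_def using assms by (blast intro: reaches_mono)

lemma leads_toE:
  assumes "leads_to P x T p q m Q"
  obtains m' where "reaches P x T (p, m) (q, m')" "Q m'"
  using assms by (auto simp: leads_to_def)

text \<open>The registers from \<open>d\<close> on act as a stack: a second operand is computed one
  register higher, so that \<open>agree\<close> preserves the first. As \<open>agree\<close> also
  fixes the array area, \<open>consistent\<close> carries over from one subexpression to the
  next.\<close>

lemma compile_expr_correct:
  assumes "code_at P p (compile_expr B r d p e)" "expr_wf e" "d + expr_regs e \<le> B"
    "consistent B x r d h s m"
  shows "leads_to P x (poly (expr_time e) (length x)) p (p + length (compile_expr B r d p e)) m
           (\<lambda>m'. m' d = eval x h s e \<and> agree B d m m')"
  using assms
proof (induction e arbitrary: r d p s m)
  case (Num c)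
  then have "p < length P" "P ! p = Const d c" by simp_all
  then have "reaches P x (Suc 0) (p, m) (Suc p, m(d := c))"
    by (rule reaches_step) (simp add: reaches_refl)
  then show ?case by (rule leads_toI) (use Num.prems in \<open>simp_all add: agree_def\<close>)
next
  case Len
  then have code: "p < length P" "P ! p = Const d 0" "Suc p < length P" "P ! Suc p = Add d d 1"
    and "m 1 = length x" "2 \<le> d"
    by (simp_all add: consistent_def)
  then have "reaches P x (Suc (Suc 0)) (p, m) (Suc (Suc p), m(d := length x))"
    by (intro reaches_step[OF code(1,2)], simp, intro reaches_step[OF code(3,4)])
      (simp add: reaches_refl)
  then show ?case
    by (rule leads_toI) (use Len.prems in \<open>simp_all add: agree_def eval_nat_numeral\<close>)
next
  case (Var v)
  then have code: "p < length P" "P ! p = Const d 0" "Suc p < length P" "P ! Suc p = Add d d (r v)"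
    by simp_all
  have "r v \<noteq> d" "m (r v) = s v" using Var by (force simp: consistent_def)+
  then have "reaches P x (Suc (Suc 0)) (p, m) (Suc (Suc p), m(d := s v))"
    by (intro reaches_step[OF code(1,2)], simp, intro reaches_step[OF code(3,4)])
      (simp add: reaches_refl)
  then show ?case
    by (rule leads_toI) (use Var.prems in \<open>simp_all add: agree_def eval_nat_numeral\<close>)
next
  case (Inp e)
  let ?c = "compile_expr B r d p e"
  let ?q = "p + length ?c"
  have code: "?q < length P" "P ! ?q = Read d d"
    using Inp.prems by simp_all
  obtain m1 where m1: "reaches P x (poly (expr_time e) (length x)) (p, m) (?q, m1)"
    "m1 d = eval x h s e" "agree B d m m1"
    using Inp.IH[of p r d s m] Inp.prems by (auto elim!: leads_toE)
  have "reaches P x (Suc 0) (?q, m1) (Suc ?q, m1(d := input_at x (eval x h s e)))"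
    by (rule reaches_step[OF code]) (use m1 in \<open>simp add: input_at_def reaches_refl\<close>)
  from reaches_trans[OF m1(1) this order_refl] show ?case
    by (rule leads_toI) (use m1 Inp.prems expr_regs_pos[of e] in \<open>simp_all add: agree_def\<close>)
next
  case (Arr a e)
  let ?c = "compile_expr B r d p e" and ?v = "eval x h s e"
  let ?q = "p + length ?c"
  have code: "?q < length P" "P ! ?q = Add d d d" "Suc ?q < length P" "P ! Suc ?q = Add d d d"
    "Suc (Suc ?q) < length P" "P ! Suc (Suc ?q) = Const (d + 1) (B + a)"
    "Suc (Suc (Suc ?q)) < length P" "P ! Suc (Suc (Suc ?q)) = Add d d (d + 1)"
    "Suc (Suc (Suc (Suc ?q))) < length P" "P ! Suc (Suc (Suc (Suc ?q))) = Load d d"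
    using Arr.prems by simp_all
  obtain m1 where m1: "reaches P x (poly (expr_time e) (length x)) (p, m) (?q, m1)"
    "m1 d = ?v" "agree B d m m1"
    using Arr.IH[of p r d s m] Arr.prems by (auto elim!: leads_toE)
  have cons: "consistent B x r d h s m1" using consistent_agree Arr.prems m1 by blast
  have "m1 (B + 4 * ?v + a) = h a ?v"
    using cons Arr.prems by (simp add: consistent_def)
  moreover have "?v + ?v + (?v + ?v) + (B + a) = B + 4 * ?v + a" by simp
  ultimately have eq: "m1 (?v + ?v + (?v + ?v) + (B + a)) = h a ?v" by (simp only:)
  \<comment> \<open>The entry lies at \<open>B\<close> or above and both registers lie below, so the
    writes preceding \<open>Load\<close> do not disturb it.\<close>
  have "d + 1 \<noteq> ?v + ?v + (?v + ?v) + (B + a)" "d \<noteq> ?v + ?v + (?v + ?v) + (B + a)"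
    using Arr.prems by simp_all
  then have "reaches P x (Suc (Suc (Suc (Suc (Suc 0))))) (?q, m1)
      (Suc (Suc (Suc (Suc (Suc ?q)))), m1(d + 1 := B + a, d := h a ?v))"
    by (intro reaches_step[OF code(1,2)], simp only: exec.simps,
        intro reaches_step[OF code(3,4)], simp only: exec.simps,
        intro reaches_step[OF code(5,6)], simp only: exec.simps,
        intro reaches_step[OF code(7,8)], simp only: exec.simps,
        intro reaches_step[OF code(9,10)]) (use eq m1 in \<open>simp add: reaches_refl fun_upd_twist\<close>)
  from reaches_trans[OF m1(1) this order_refl] show ?case
    by (rule leads_toI) (use m1 Arr.prems in \<open>simp_all add: agree_def eval_nat_numeral\<close>)
next
  case (Plus e1 e2)
  let ?c1 = "compile_expr B r d p e1"
  let ?p2 = "p + length ?c1"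
  let ?c2 = "compile_expr B r (d + 1) ?p2 e2"
  let ?q = "?p2 + length ?c2"
  let ?v = "eval x h s (Plus e1 e2)"
  have code: "?q < length P" "P ! ?q = Add d d (d + 1)" "code_at P p ?c1" "code_at P ?p2 ?c2"
    using Plus.prems by (simp_all add: Let_def add_ac)
  obtain m1 where m1: "reaches P x (poly (expr_time e1) (length x)) (p, m) (?p2, m1)"
    "m1 d = eval x h s e1" "agree B d m m1"
    using Plus.IH(1)[of p r d s m] Plus.prems code by (auto elim!: leads_toE)
  have "consistent B x r (d + 1) h s m1"
    using consistent_agree Plus.prems m1 consistent_Suc by auto
  then obtain m2 where m2: "reaches P x (poly (expr_time e2) (length x)) (?p2, m1) (?q, m2)"
    "m2 (d + 1) = eval x h s e2" "agree B (d + 1) m1 m2"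
    using Plus.IH(2)[of ?p2 r "d + 1" s m1] Plus.prems code by (auto elim!: leads_toE)
  have "m2 d = m1 d" using m2(3) by (simp add: agree_def)
  then have "reaches P x (Suc 0) (?q, m2) (Suc ?q, m2(d := ?v))"
    by (intro reaches_step[OF code(1,2)]) (use m1 m2 in \<open>simp add: reaches_refl\<close>)
  from reaches_trans[OF m1(1) reaches_trans[OF m2(1) this order_refl] order_refl]
  show ?case
    by (rule leads_toI)
      (use m1 m2 Plus.prems expr_regs_pos[of e1] in \<open>simp_all add: agree_def Let_def add_ac\<close>)
next
  case (Minus e1 e2)
  let ?c1 = "compile_expr B r d p e1"
  let ?p2 = "p + length ?c1"
  let ?c2 = "compile_expr B r (d + 1) ?p2 e2"
  let ?q = "?p2 + length ?c2"
  let ?v = "eval x h s (Minus e1 e2)"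
  have code: "?q < length P" "P ! ?q = Sub d d (d + 1)" "code_at P p ?c1" "code_at P ?p2 ?c2"
    using Minus.prems by (simp_all add: Let_def add_ac)
  obtain m1 where m1: "reaches P x (poly (expr_time e1) (length x)) (p, m) (?p2, m1)"
    "m1 d = eval x h s e1" "agree B d m m1"
    using Minus.IH(1)[of p r d s m] Minus.prems code by (auto elim!: leads_toE)
  have "consistent B x r (d + 1) h s m1"
    using consistent_agree Minus.prems m1 consistent_Suc by auto
  then obtain m2 where m2: "reaches P x (poly (expr_time e2) (length x)) (?p2, m1) (?q, m2)"
    "m2 (d + 1) = eval x h s e2" "agree B (d + 1) m1 m2"
    using Minus.IH(2)[of ?p2 r "d + 1" s m1] Minus.prems code by (auto elim!: leads_toE)
  have "m2 d = m1 d" using m2(3) by (simp add: agree_def)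
  then have "reaches P x (Suc 0) (?q, m2) (Suc ?q, m2(d := ?v))"
    by (intro reaches_step[OF code(1,2)]) (use m1 m2 in \<open>simp add: reaches_refl\<close>)
  from reaches_trans[OF m1(1) reaches_trans[OF m2(1) this order_refl] order_refl]
  show ?case
    by (rule leads_toI)
      (use m1 m2 Minus.prems expr_regs_pos[of e1] in \<open>simp_all add: agree_def Let_def add_ac\<close>)
next
  case (Ite e e1 e2)
  let ?c = "compile_expr B r d p e"
  let ?p2 = "p + length ?c + 1"
  let ?c2 = "compile_expr B r d ?p2 e2"
  let ?q = "p + length ?c + length ?c2 + 2"
  let ?c1 = "compile_expr B r d ?q e1"
  let ?t = "\<lambda>e. poly (expr_time e) (length x)"
  have code: "code_at P p ?c" "p + length ?c < length P" "P ! (p + length ?c) = JumpPos d ?q"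
    "code_at P ?p2 ?c2" "?p2 + length ?c2 < length P"
    "P ! (?p2 + length ?c2) = JumpPos 0 (?q + length ?c1)" "code_at P ?q ?c1"
    using Ite.prems(1) by (auto simp: Let_def)
  obtain m1 where m1: "reaches P x (?t e) (p, m) (p + length ?c, m1)"
    "m1 d = eval x h s e" "agree B d m m1"
    using Ite.IH(1)[of p r d s m] Ite.prems code by (auto elim!: leads_toE)
  have cons: "consistent B x r d h s m1" using consistent_agree Ite.prems m1 by blast
  have len: "p + length (compile_expr B r d p (Ite e e1 e2)) = ?q + length ?c1"
    by (simp add: Let_def)
  have "\<exists>m2. reaches P x (?t e1 + ?t e2 + 2) (p + length ?c, m1) (?q + length ?c1, m2) \<and>
      m2 d = eval x h s (Ite e e1 e2) \<and> agree B d m1 m2"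
  proof (cases "eval x h s e > 0")
    case True
    obtain m2 where m2: "reaches P x (?t e1) (?q, m1) (?q + length ?c1, m2)"
      "m2 d = eval x h s e1" "agree B d m1 m2"
      using Ite.IH(2)[of ?q r d s m1] Ite.prems code cons by (auto elim!: leads_toE)
    have "reaches P x (Suc (?t e1)) (p + length ?c, m1) (?q + length ?c1, m2)"
      by (rule reaches_step) (use code m1 m2 True in auto)
    from reaches_mono[OF this, of "?t e1 + ?t e2 + 2"] m2 True show ?thesis by auto
  next
    case False
    obtain m2 where m2: "reaches P x (?t e2) (?p2, m1) (?p2 + length ?c2, m2)"
      "m2 d = eval x h s e2" "agree B d m1 m2"
      using Ite.IH(3)[of ?p2 r d s m1] Ite.prems code cons by (auto elim!: leads_toE)
    have "m2 0 = 1" using consistent_agree[OF cons m2(3)] by (simp add: consistent_def)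
    then have "reaches P x (Suc 0) (?p2 + length ?c2, m2) (?q + length ?c1, m2)"
      by (intro reaches_step[OF code(5,6)]) (simp add: reaches_refl)
    from reaches_trans[OF m2(1) this order_refl]
    have "reaches P x (Suc (?t e2 + Suc 0)) (p + length ?c, m1) (?q + length ?c1, m2)"
      by (intro reaches_step[OF code(2,3)]) (use m1 False in auto)
    from reaches_mono[OF this, of "?t e1 + ?t e2 + 2"] m2 False show ?thesis by auto
  qed
  then obtain m2 where m2: "reaches P x (?t e1 + ?t e2 + 2) (p + length ?c, m1) (?q + length ?c1, m2)"
      "m2 d = eval x h s (Ite e e1 e2)" "agree B d m1 m2" by blast
  have "reaches P x (?t (Ite e e1 e2)) (p, m) (?q + length ?c1, m2)"
    by (rule reaches_trans[OF m1(1) m2(1)]) simp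
  then show ?case
    unfolding len by (rule leads_toI) (use m1 m2 in \<open>auto simp: agree_def\<close>)
next
  case (Bsum v e)
  let ?r = "r(v := d + 1)"
  let ?c = "compile_expr B ?r (d + 2) (p + 5) e"
  let ?T = "poly (expr_time e) (length x)"
  let ?S = "\<lambda>n. \<Sum>k<n. eval x h (s(v := k)) e"
  let ?I = "\<lambda>n m'. m' d = ?S n \<and> m' (d + 1) = n \<and> agree B d m m'"
  have code0: "p < length P" "P ! p = Const d 0"
    and code1: "Suc p < length P" "P ! Suc p = Const (d + 1) 0"
    and code2: "p + 2 < length P" "P ! (p + 2) = Sub (d + 2) 1 (d + 1)"
    and code3: "Suc (p + 2) < length P" "P ! Suc (p + 2) = JumpPos (d + 2) (p + 5)"
    and code4: "Suc (Suc (p + 2)) < length P"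
      "P ! Suc (Suc (p + 2)) = JumpPos 0 (p + length ?c + 8)"
    and code5: "code_at P (p + 5) ?c"
    and code6: "p + 5 + length ?c < length P" "P ! (p + 5 + length ?c) = Add d d (d + 2)"
    and code7: "Suc (p + 5 + length ?c) < length P"
      "P ! Suc (p + 5 + length ?c) = Add (d + 1) (d + 1) 0"
    and code8: "Suc (Suc (p + 5 + length ?c)) < length P"
      "P ! Suc (Suc (p + 5 + length ?c)) = JumpPos 0 (p + 2)"
    using Bsum.prems(1) by (simp_all add: Let_def eval_nat_numeral)
  have B: "d + 3 \<le> B" using Bsum.prems by simp
  have d: "2 \<le> d" and m01: "m 0 = 1" "m 1 = length x"
    using Bsum.prems by (auto simp: consistent_def)
  have loop: "leads_to P x (n * (?T + 5) + 2) p (p + 2) m (?I n)" if "n \<le> length x" for n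
    using that
  proof (induction n)
    case 0
    have "reaches P x (Suc (Suc 0)) (p, m) (Suc (Suc p), m(d := 0, d + 1 := 0))"
      by (intro reaches_step[OF code0], simp only: exec.simps, intro reaches_step[OF code1])
        (simp add: reaches_refl)
    then show ?case
      by (rule leads_toI) (use B in \<open>auto simp: agree_def eval_nat_numeral\<close>)
  next
    case (Suc n)
    have "leads_to P x (n * (?T + 5) + 2) p (p + 2) m (?I n)"
      using Suc.prems by (intro Suc.IH) simp
    then obtain m1 where m1: "reaches P x (n * (?T + 5) + 2) (p, m) (p + 2, m1)" "?I n m1"
      by (rule leads_toE)
    let ?m1 = "m1(d + 2 := length x - n)"
    have m1': "m1 0 = 1" "m1 1 = length x" using m1 d m01 by (auto simp: agree_def)
    have "exec x (Sub (d + 2) 1 (d + 1)) (p + 2, m1) = (Suc (p + 2), ?m1)"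
      using m1 m1' by simp
    moreover have "reaches P x (Suc 0) (Suc (p + 2), ?m1) (p + 5, ?m1)"
      by (rule reaches_step[OF code3]) (use Suc.prems in \<open>simp add: reaches_refl\<close>)
    ultimately have "reaches P x (Suc (Suc 0)) (p + 2, m1) (p + 5, ?m1)"
      by (intro reaches_step[OF code2]) simp
    note a = reaches_trans[OF m1(1) this order_refl]
    \<comment> \<open>The counter register \<open>d + 1\<close> itself represents the bound
      variable, and the partial sum waits in \<open>d\<close>; both are below the registers that the
      body may write.\<close>
    have cons: "consistent B x ?r (d + 2) h (s(v := n)) ?m1"
      unfolding consistent_def
    proof (intro conjI allI impI)
      fix w
      have "r w < d" "m (r w) = s w" using Bsum.prems(4) by (auto simp: consistent_def)
      then show "?r w < d + 2" "?m1 (?r w) = (s(v := n)) w"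
        using m1 by (auto simp: agree_def)
    next
      fix a i :: nat assume "a < 4"
      then show "?m1 (B + 4 * i + a) = h a i"
        using m1 B Bsum.prems(4) by (auto simp: consistent_def agree_def)
    qed (use m1' d in auto)
    have "leads_to P x ?T (p + 5) (p + 5 + length ?c) ?m1
        (\<lambda>m'. m' (d + 2) = eval x h (s(v := n)) e \<and> agree B (d + 2) ?m1 m')"
      by (rule Bsum.IH[OF code5 _ _ cons]) (use Bsum.prems in simp_all)
    then obtain m2 where m2: "reaches P x ?T (p + 5, ?m1) (p + 5 + length ?c, m2)"
      "m2 (d + 2) = eval x h (s(v := n)) e \<and> agree B (d + 2) ?m1 m2"
      by (rule leads_toE)
    have m2': "m2 0 = 1" "m2 d = ?S n" "m2 (d + 1) = n"
      using m2(2) m1' d m1(2) by (auto simp: agree_def)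
    let ?m3 = "m2(d := ?S (Suc n))"
    let ?m4 = "?m3(d + 1 := Suc n)"
    have "exec x (Add d d (d + 2)) (p + 5 + length ?c, m2) = (Suc (p + 5 + length ?c), ?m3)"
      using m2 m2' by simp
    moreover have "exec x (Add (d + 1) (d + 1) 0) (Suc (p + 5 + length ?c), ?m3) =
        (Suc (Suc (p + 5 + length ?c)), ?m4)"
      using m2' d by simp
    moreover have "reaches P x (Suc 0) (Suc (Suc (p + 5 + length ?c)), ?m4) (p + 2, ?m4)"
      by (rule reaches_step[OF code8]) (use m2' d in \<open>simp add: reaches_refl\<close>)
    ultimately have "reaches P x (Suc (Suc (Suc 0))) (p + 5 + length ?c, m2) (p + 2, ?m4)"
      by (intro reaches_step[OF code6], simp only:, intro reaches_step[OF code7], simp only:)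
    from reaches_trans[OF a reaches_trans[OF m2(1) this order_refl] order_refl]
    have "reaches P x (Suc n * (?T + 5) + 2) (p, m) (p + 2, ?m4)"
      by (rule reaches_mono) simp
    then show ?case
      by (rule leads_toI) (use m1(2) m2(2) B in \<open>auto simp: agree_def fun_upd_def\<close>)
  qed
  obtain m1 where m1: "reaches P x (length x * (?T + 5) + 2) (p, m) (p + 2, m1)"
    "?I (length x) m1" using loop[OF order_refl] by (rule leads_toE)
  let ?m2 = "m1(d + 2 := 0)"
  have m1': "m1 0 = 1" "m1 1 = length x" using m1 d m01 by (auto simp: agree_def)
  have "exec x (Sub (d + 2) 1 (d + 1)) (p + 2, m1) = (Suc (p + 2), ?m2)"
    using m1 m1' by simp
  moreover have "exec x (JumpPos (d + 2) (p + 5)) (Suc (p + 2), ?m2) = (Suc (Suc (p + 2)), ?m2)"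
    by simp
  moreover have "reaches P x (Suc 0) (Suc (Suc (p + 2)), ?m2) (p + length ?c + 8, ?m2)"
    by (rule reaches_step[OF code4]) (use m1' in \<open>simp add: reaches_refl\<close>)
  ultimately have "reaches P x (Suc (Suc (Suc 0))) (p + 2, m1) (p + length ?c + 8, ?m2)"
    by (intro reaches_step[OF code2], simp only:, intro reaches_step[OF code3], simp only:)
  from reaches_trans[OF m1(1) this order_refl]
  have "reaches P x (poly (expr_time (Bsum v e)) (length x)) (p, m) (p + length ?c + 8, ?m2)"
    by (rule reaches_mono) simp
  then show ?case
    by (rule leads_toI) (use m1 B in \<open>auto simp: agree_def Let_def\<close>)
qed

text \<open>Because of \<open>a < 4\<close> an address determines array and index, so that one write
  changes one entry; because of \<open>d \<le> B\<close> the write misses the registers in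
  use.\<close>

lemma consistent_put:
  assumes "consistent B x r d h s m" "d \<le> B" "a < 4"
  shows "consistent B x r d (put a i c h) s (m(B + 4 * i + a := c))"
proof -
  have eq: "B + 4 * j + b = B + 4 * i + a \<longleftrightarrow> j = i \<and> b = a" if "b < 4" for b j
    using that assms(3) by presburger
  show ?thesis
    unfolding consistent_def
  proof (intro conjI allI impI)
    fix b j :: nat assume "b < 4"
    then show "(m(B + 4 * i + a := c)) (B + 4 * j + b) = put a i c h b j"
      using assms eq[of b j] by (auto simp: consistent_def put_def)
  next
    fix v
    have "r v < d" "m (r v) = s v" using assms(1) by (auto simp: consistent_def)
    then show "r v < d" "(m(B + 4 * i + a := c)) (r v) = s v" using assms(2) by simp_all
  qed (use assms in \<open>auto simp: consistent_def\<close>)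
qed

text \<open>A command writes to the arrays, so \<open>agree\<close> would be too strong. It is
  enough that the registers below \<open>d\<close> keep their values, among them the counters of the
  enclosing loops.\<close>

lemma compile_cmd_correct:
  assumes "code_at P p (compile_cmd B r d p c)" "cmd_wf c" "d + cmd_regs c \<le> B"
    "consistent B x r d h s m"
  shows "leads_to P x (poly (cmd_time c) (length x)) p (p + length (compile_cmd B r d p c)) m
           (\<lambda>m'. consistent B x r d (run x s c h) s m' \<and> (\<forall>k<d. m' k = m k))"
  using assms
proof (induction c arbitrary: r d p s m h)
  case (Put a e1 e2)
  let ?c1 = "compile_expr B r d p e1"
  let ?q = "p + length ?c1"
  let ?q4 = "Suc (Suc (Suc (Suc ?q)))"
  let ?c2 = "compile_expr B r (d + 1) ?q4 e2"
  let ?i = "eval x h s e1" and ?v = "eval x h s e2"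
  have q4: "?q + 4 = ?q4" by simp
  have code: "?q < length P" "P ! ?q = Add d d d" "Suc ?q < length P" "P ! Suc ?q = Add d d d"
    "Suc (Suc ?q) < length P" "P ! Suc (Suc ?q) = Const (d + 1) (B + a)"
    "Suc (Suc (Suc ?q)) < length P" "P ! Suc (Suc (Suc ?q)) = Add d d (d + 1)"
    "code_at P p ?c1" "code_at P ?q4 ?c2"
    "?q4 + length ?c2 < length P" "P ! (?q4 + length ?c2) = Store d (d + 1)"
    using Put.prems(1) unfolding compile_cmd.simps Let_def q4 by simp_all
  obtain m1 where m1: "reaches P x (poly (expr_time e1) (length x)) (p, m) (?q, m1)"
    "m1 d = ?i" "agree B d m m1"
    using compile_expr_correct[OF code(9), of x h s m] Put.prems by (auto elim!: leads_toE)
  have cons: "consistent B x r d h s m1" using consistent_agree Put.prems m1 by blast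
  let ?m1 = "m1(d + 1 := B + a, d := B + 4 * ?i + a)"
  have addr: "B + 4 * ?i + a = ?i + ?i + (?i + ?i) + (B + a)" by simp
  have "reaches P x (Suc (Suc (Suc (Suc 0)))) (?q, m1) (?q4, ?m1)"
    unfolding addr
    by (intro reaches_step[OF code(1,2)], simp only: exec.simps,
        intro reaches_step[OF code(3,4)], simp only: exec.simps,
        intro reaches_step[OF code(5,6)], simp only: exec.simps,
        intro reaches_step[OF code(7,8)])
      (use m1 in \<open>simp add: reaches_refl fun_upd_twist\<close>)
  note a = reaches_trans[OF m1(1) this order_refl]
  have "agree B d m1 ?m1" using Put.prems by (simp add: agree_def)
  then have cons1: "consistent B x r d h s ?m1" using consistent_agree cons by blast
  then obtain m2 where m2: "reaches P x (poly (expr_time e2) (length x)) (?q4, ?m1)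
      (?q4 + length ?c2, m2)"
    "m2 (d + 1) = ?v" "agree B (d + 1) ?m1 m2"
    using compile_expr_correct[OF code(10), of x h s ?m1] consistent_Suc Put.prems
    by (auto elim!: leads_toE)
  let ?m3 = "m2(B + 4 * ?i + a := ?v)"
  have m2d: "m2 d = B + 4 * ?i + a" using m2(3) by (simp add: agree_def)
  have "agree B d ?m1 m2" using m2(3) by (simp add: agree_def)
  then have "consistent B x r d h s m2" using consistent_agree cons1 by blast
  then have cons3: "consistent B x r d (run x s (Put a e1 e2) h) s ?m3"
    unfolding run.simps by (rule consistent_put) (use Put.prems in simp_all)
  have "reaches P x (Suc 0) (?q4 + length ?c2, m2) (Suc (?q4 + length ?c2), ?m3)"
    by (rule reaches_step[OF code(11,12)]) (use m2d m2 in \<open>simp add: reaches_refl\<close>)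
  from reaches_trans[OF a reaches_trans[OF m2(1) this order_refl] order_refl] show ?case
  proof (rule leads_toI)
    show "consistent B x r d (run x s (Put a e1 e2) h) s ?m3 \<and> (\<forall>k<d. ?m3 k = m k)"
      using cons3 m1(3) m2(3) Put.prems by (auto simp: agree_def)
  qed (simp_all add: Let_def eval_nat_numeral)
next
  case (Seq c1 c2)
  let ?c1 = "compile_cmd B r d p c1"
  let ?q = "p + length ?c1"
  let ?c2 = "compile_cmd B r d ?q c2"
  have code: "code_at P p ?c1" "code_at P ?q ?c2"
    using Seq.prems by (simp_all add: Let_def)
  have "leads_to P x (poly (cmd_time c1) (length x)) p ?q m
           (\<lambda>m'. consistent B x r d (run x s c1 h) s m' \<and> (\<forall>k<d. m' k = m k))"
    by (rule Seq.IH(1)[OF code(1)]) (use Seq.prems in simp_all)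
  then obtain m1 where m1: "reaches P x (poly (cmd_time c1) (length x)) (p, m) (?q, m1)"
    "consistent B x r d (run x s c1 h) s m1 \<and> (\<forall>k<d. m1 k = m k)"
    by (rule leads_toE)
  have "leads_to P x (poly (cmd_time c2) (length x)) ?q (?q + length ?c2) m1
      (\<lambda>m'. consistent B x r d (run x s c2 (run x s c1 h)) s m' \<and> (\<forall>k<d. m' k = m1 k))"
    by (rule Seq.IH(2)[OF code(2)]) (use Seq.prems m1 in simp_all)
  then obtain m2 where m2: "reaches P x (poly (cmd_time c2) (length x)) (?q, m1) (?q + length ?c2, m2)"
    "consistent B x r d (run x s c2 (run x s c1 h)) s m2 \<and> (\<forall>k<d. m2 k = m1 k)"
    by (rule leads_toE)
  from reaches_trans[OF m1(1) m2(1) order_refl] show ?case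
    by (rule leads_toI) (use m1(2) m2(2) in \<open>simp_all add: Let_def\<close>)
next
  case (IfC e c)
  let ?c1 = "compile_expr B r d p e"
  let ?q = "p + length ?c1"
  let ?c2 = "compile_cmd B r d (?q + 2) c"
  let ?T = "poly (cmd_time c) (length x)"
  have code: "code_at P p ?c1" "?q < length P" "P ! ?q = JumpPos d (?q + 2)"
    "Suc ?q < length P" "P ! Suc ?q = JumpPos 0 (?q + 2 + length ?c2)" "code_at P (?q + 2) ?c2"
    using IfC.prems(1) by (simp_all add: Let_def)
  obtain m1 where m1: "reaches P x (poly (expr_time e) (length x)) (p, m) (?q, m1)"
    "m1 d = eval x h s e" "agree B d m m1"
    using compile_expr_correct[OF code(1), of x h s m] IfC.prems by (auto elim!: leads_toE)
  have cons: "consistent B x r d h s m1" using consistent_agree IfC.prems m1 by blast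
  have m1d: "\<forall>k<d. m1 k = m k" using m1 by (simp add: agree_def)
  have len: "length (compile_cmd B r d p (IfC e c)) = length ?c1 + 2 + length ?c2"
    by (simp add: Let_def)
  show ?case
  proof (cases "eval x h s e > 0")
    case True
    have "leads_to P x ?T (?q + 2) (?q + 2 + length ?c2) m1
      (\<lambda>m'. consistent B x r d (run x s c h) s m' \<and> (\<forall>k<d. m' k = m1 k))"
      by (rule IfC.IH[OF code(6)]) (use IfC.prems cons in simp_all)
    then obtain m2 where m2: "reaches P x ?T (?q + 2, m1) (?q + 2 + length ?c2, m2)"
      "consistent B x r d (run x s c h) s m2 \<and> (\<forall>k<d. m2 k = m1 k)"
      by (rule leads_toE)
    have "reaches P x (Suc ?T) (?q, m1) (?q + 2 + length ?c2, m2)"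
      by (rule reaches_step[OF code(2,3)]) (use m1 m2 True in simp)
    from reaches_trans[OF m1(1) this order_refl] show ?thesis
      by (rule leads_toI) (use m2(2) m1d True len in auto)
  next
    case False
    have "m1 0 = 1" using cons by (simp add: consistent_def)
    then have "reaches P x (Suc 0) (Suc ?q, m1) (?q + 2 + length ?c2, m1)"
      by (intro reaches_step[OF code(4,5)]) (simp add: reaches_refl)
    then have "reaches P x (Suc (Suc 0)) (?q, m1) (?q + 2 + length ?c2, m1)"
      by (intro reaches_step[OF code(2,3)]) (use m1 False in simp)
    from reaches_trans[OF m1(1) this order_refl] show ?thesis
      by (rule leads_toI) (use cons m1d False len in auto)
  qed
next
  case (For v c)
  let ?r = "r(v := d)"
  let ?c = "compile_cmd B ?r (d + 1) (p + 4) c"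
  let ?T = "poly (cmd_time c) (length x)"
  let ?f = "\<lambda>k. run x (s(v := k)) c"
  let ?I = "\<lambda>n m'. consistent B x r d (fold ?f [0..<n] h) s m' \<and> m' d = n \<and>
     (\<forall>k<d. m' k = m k)"
  let ?q = "p + 4 + length ?c"
  have code0: "p < length P" "P ! p = Const d 0"
    and code1: "Suc p < length P" "P ! Suc p = Sub (d + 1) 1 d"
    and code2: "Suc (Suc p) < length P" "P ! Suc (Suc p) = JumpPos (d + 1) (p + 4)"
    and code3: "Suc (Suc (Suc p)) < length P" "P ! Suc (Suc (Suc p)) = JumpPos 0 (?q + 2)"
    and code4: "code_at P (p + 4) ?c"
    and code5: "?q < length P" "P ! ?q = Add d d 0"
    and code6: "Suc ?q < length P" "P ! Suc ?q = JumpPos 0 (Suc p)"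
    using For.prems(1) by (simp_all add: Let_def eval_nat_numeral)
  have B: "d + 2 \<le> B" using For.prems by simp
  have cons0: "consistent B x r d h s m'" if "agree B d m m'" for m'
    using that For.prems consistent_agree by blast
  have loop: "leads_to P x (n * (?T + 4) + 1) p (Suc p) m (?I n)" if "n \<le> length x" for n
    using that
  proof (induction n)
    case 0
    have "reaches P x (Suc 0) (p, m) (Suc p, m(d := 0))"
      by (rule reaches_step[OF code0]) (simp add: reaches_refl)
    then show ?case
      by (rule leads_toI) (use B cons0[of "m(d := 0)"] in \<open>auto simp: agree_def fun_upd_def\<close>)
  next
    case (Suc n)
    let ?h = "fold ?f [0..<n] h"
    have "leads_to P x (n * (?T + 4) + 1) p (Suc p) m (?I n)"
      using Suc.prems by (intro Suc.IH) simp
    then obtain m1 where m1: "reaches P x (n * (?T + 4) + 1) (p, m) (Suc p, m1)" "?I n m1"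
      by (rule leads_toE)
    let ?m1 = "m1(d + 1 := length x - n)"
    have m1': "m1 1 = length x" using m1 by (auto simp: consistent_def)
    have "exec x (Sub (d + 1) 1 d) (Suc p, m1) = (Suc (Suc p), ?m1)"
      using m1 m1' by simp
    moreover have "reaches P x (Suc 0) (Suc (Suc p), ?m1) (p + 4, ?m1)"
      by (rule reaches_step[OF code2]) (use Suc.prems in \<open>simp add: reaches_refl\<close>)
    ultimately have "reaches P x (Suc (Suc 0)) (Suc p, m1) (p + 4, ?m1)"
      by (intro reaches_step[OF code1]) simp
    note a = reaches_trans[OF m1(1) this order_refl]
    have cons: "consistent B x ?r (d + 1) ?h (s(v := n)) ?m1"
      unfolding consistent_def
    proof (intro conjI allI impI)
      fix w
      have "r w < d" "m1 (r w) = s w" "m1 d = n" using m1(2) by (auto simp: consistent_def)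
      then show "?r w < d + 1" "?m1 (?r w) = (s(v := n)) w"
        by auto
    next
      fix a i :: nat assume "a < 4"
      then show "?m1 (B + 4 * i + a) = ?h a i"
        using m1(2) B by (auto simp: consistent_def)
    qed (use m1 in \<open>auto simp: consistent_def\<close>)
    have "leads_to P x ?T (p + 4) ?q ?m1
       (\<lambda>m'. consistent B x ?r (d + 1) (?f n ?h) (s(v := n)) m' \<and> (\<forall>k<d + 1. m' k = ?m1 k))"
      by (rule For.IH[OF code4 _ _ cons]) (use For.prems in simp_all)
    then obtain m2 where m2: "reaches P x ?T (p + 4, ?m1) (?q, m2)"
      "consistent B x ?r (d + 1) (?f n ?h) (s(v := n)) m2 \<and> (\<forall>k<d + 1. m2 k = ?m1 k)"
      by (rule leads_toE)
    have m2': "m2 0 = 1" "m2 d = n"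
      using m2(2) m1(2) by (auto simp: consistent_def)
    let ?m3 = "m2(d := Suc n)"
    have "exec x (Add d d 0) (?q, m2) = (Suc ?q, ?m3)"
      using m2' by simp
    moreover have "reaches P x (Suc 0) (Suc ?q, ?m3) (Suc p, ?m3)"
      by (rule reaches_step[OF code6]) (use m2' in \<open>simp add: reaches_refl\<close>)
    ultimately have "reaches P x (Suc (Suc 0)) (?q, m2) (Suc p, ?m3)"
      by (intro reaches_step[OF code5]) simp
    from reaches_trans[OF a reaches_trans[OF m2(1) this order_refl] order_refl]
    show ?case
    proof (rule leads_toI)
      have eq: "fold ?f [0..<Suc n] h = ?f n ?h" by simp
      have "consistent B x r d (fold ?f [0..<Suc n] h) s ?m3"
        unfolding eq consistent_def
      proof (intro conjI allI impI)
        fix w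
        have "r w < d" "m1 (r w) = s w" using m1(2) by (auto simp: consistent_def)
        then show "r w < d" "?m3 (r w) = s w"
          using m2(2) by auto
      next
        fix a i :: nat assume "a < 4"
        then show "?m3 (B + 4 * i + a) = ?f n ?h a i"
          using m2(2) B by (auto simp: consistent_def)
      qed (use m1 m2 in \<open>auto simp: consistent_def\<close>)
      then show "?I (Suc n) ?m3" using m1(2) m2(2) by simp
    qed simp_all
  qed
  obtain m1 where m1: "reaches P x (length x * (?T + 4) + 1) (p, m) (Suc p, m1)"
    "?I (length x) m1" using loop[OF order_refl] by (rule leads_toE)
  let ?m2 = "m1(d + 1 := 0)"
  have m1': "m1 0 = 1" "m1 1 = length x" "2 \<le> d" using m1 by (auto simp: consistent_def)
  have "exec x (Sub (d + 1) 1 d) (Suc p, m1) = (Suc (Suc p), ?m2)"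
    using m1 m1' by simp
  moreover have "exec x (JumpPos (d + 1) (p + 4)) (Suc (Suc p), ?m2) = (Suc (Suc (Suc p)), ?m2)"
    by simp
  moreover have "reaches P x (Suc 0) (Suc (Suc (Suc p)), ?m2) (?q + 2, ?m2)"
    by (rule reaches_step[OF code3]) (use m1' in \<open>simp add: reaches_refl\<close>)
  ultimately have "reaches P x (Suc (Suc (Suc 0))) (Suc p, m1) (?q + 2, ?m2)"
    by (intro reaches_step[OF code1], simp only:, intro reaches_step[OF code2], simp only:)
  from reaches_trans[OF m1(1) this order_refl] show ?case
  proof (rule leads_toI)
    have "agree B d m1 ?m2" using B by (simp add: agree_def)
    then show "consistent B x r d (run x s (For v c) h) s ?m2 \<and> (\<forall>k<d. ?m2 k = m k)"
      using m1(2) consistent_agree by fastforce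
  qed (simp_all add: Let_def)
qed

lemma poly_nat_mono:
  fixes p :: "nat poly" and m n :: nat
  shows "m \<le> n \<Longrightarrow> poly p m \<le> poly p n"
  by (induction p) (auto intro!: mult_mono)

lemma length_le_bit_size: "length x \<le> bit_size x"
  unfolding bit_size_def by (induction x) auto

text \<open>Each number contributes at least 1 to the bit size, and polynomials over the naturals
  are monotone, so a time bound in terms of the length suffices.\<close>

lemma poly_time_decidable_loop_program:
  assumes "cmd_wf c" "expr_wf e"
    and "\<And>x. eval x (run x (\<lambda>_. length x) c (\<lambda>_ _. 0)) (\<lambda>_. length x) e = (if x \<in> L then 1 else 0)"
  shows "poly_time_decidable L"
proof -
  define B where "B = 4 + cmd_regs c + expr_regs e"
  define C where "C = compile_cmd B (\<lambda>_. 1) 2 2 c"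
  define q where "q = 2 + length C"
  define E where "E = compile_expr B (\<lambda>_. 1) 2 q e"
  \<comment> \<open>The machine starts with the length in register 0 and zeros elsewhere, so
    \<open>Add 1 0 2\<close> copies the length to register 1. The last two instructions copy the
    value of \<open>e\<close> from register 2 to the output register. These are the 4 additional
    steps in \<open>T\<close>.\<close>
  define P where "P = [Add 1 0 2, Const 0 1] @ C @ E @ [Const 3 0, Add 0 2 3]"
  define T where "T = cmd_time c + expr_time e + [:4:]"
  have "decides_within P L (\<lambda>x. poly T (bit_size x))"
    unfolding decides_within_def
  proof
    fix x :: "nat list"
    let ?s = "\<lambda>_::nat. length x"
    let ?zero = "\<lambda>_ _. 0 :: nat"
    let ?h = "run x ?s c ?zero"
    let ?m0 = "(\<lambda>_. 0::nat)(0 := 1, 1 := length x)"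
    let ?N = "length x"
    have code: "0 < length P" "P ! 0 = Add 1 0 2" "Suc 0 < length P" "P ! Suc 0 = Const 0 1"
      "code_at P 2 C" "code_at P q E" "q + length E < length P" "P ! (q + length E) = Const 3 0"
      "Suc (q + length E) < length P" "P ! Suc (q + length E) = Add 0 2 3"
      "length P = Suc (Suc (q + length E))"
    proof -
      have "code_at P 0 P" by (simp add: code_at_def)
      moreover have "Suc (Suc 0) = 2" by simp
      ultimately show "0 < length P" "P ! 0 = Add 1 0 2" "Suc 0 < length P" "P ! Suc 0 = Const 0 1"
        "code_at P 2 C" "code_at P q E" "q + length E < length P" "P ! (q + length E) = Const 3 0"
        "Suc (q + length E) < length P" "P ! Suc (q + length E) = Add 0 2 3"
        unfolding P_def q_def by (simp_all del: One_nat_def add_2_eq_Suc)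
    qed (simp add: P_def q_def)
    have "reaches P x (Suc (Suc 0)) (0, (\<lambda>_. 0)(0 := ?N)) (2, ?m0)"
      by (intro reaches_step[OF code(1,2)], simp only: exec.simps, intro reaches_step[OF code(3,4)])
        (simp add: reaches_refl fun_upd_twist eval_nat_numeral)
    moreover have "init x = (0, (\<lambda>_. 0)(0 := ?N))" by (simp add: init_def)
    ultimately have 1: "reaches P x (Suc (Suc 0)) (init x) (2, ?m0)" by simp
    have cons: "consistent B x (\<lambda>_. 1) 2 ?zero ?s ?m0"
      by (auto simp: consistent_def B_def)
    have "leads_to P x (poly (cmd_time c) ?N) 2 (2 + length C) ?m0
       (\<lambda>m'. consistent B x (\<lambda>_. 1) 2 ?h ?s m' \<and> (\<forall>k<2. m' k = ?m0 k))"
      unfolding C_def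
      by (rule compile_cmd_correct[OF _ _ _ cons]) (use assms code in \<open>simp_all add: C_def B_def\<close>)
    then obtain m1 where m1: "reaches P x (poly (cmd_time c) ?N) (2, ?m0) (2 + length C, m1)"
      "consistent B x (\<lambda>_. 1) 2 ?h ?s m1 \<and> (\<forall>k<2. m1 k = ?m0 k)"
      by (rule leads_toE)
    have "leads_to P x (poly (expr_time e) ?N) q (q + length E) m1
       (\<lambda>m'. m' 2 = eval x ?h ?s e \<and> agree B 2 m1 m')"
      unfolding E_def
      by (rule compile_expr_correct[OF _ _ _ conjunct1[OF m1(2)]]) (use assms code in \<open>simp_all add: E_def B_def\<close>)
    then obtain m2 where m2: "reaches P x (poly (expr_time e) ?N) (q, m1) (q + length E, m2)"
      "m2 2 = eval x ?h ?s e \<and> agree B 2 m1 m2"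
      by (rule leads_toE)
    let ?m3 = "m2(3 := 0, 0 := eval x ?h ?s e)"
    have 3: "reaches P x (Suc (Suc 0)) (q + length E, m2) (length P, ?m3)"
      unfolding code(11)
      by (intro reaches_step[OF code(7,8)], simp only: exec.simps, intro reaches_step[OF code(9,10)])
        (use m2 in \<open>simp add: reaches_refl\<close>)
    have "reaches P x (poly T ?N) (init x) (length P, ?m3)"
      by (rule reaches_mono[OF reaches_trans[OF 1 reaches_trans[OF m1(1)[folded q_def]
        reaches_trans[OF m2(1) 3 order_refl] order_refl] order_refl]])
        (simp add: T_def)
    then obtain t where t: "t \<le> poly T ?N" "(step P x ^^ t) (init x) = (length P, ?m3)"
      by (auto simp: reaches_def)
    moreover have "poly T ?N \<le> poly T (bit_size x)"
      by (intro poly_nat_mono length_le_bit_size)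
    ultimately show "\<exists>t\<le>poly T (bit_size x). let c = (step P x ^^ t) (init x) in
        halted P c \<and> snd c 0 = (if x \<in> L then 1 else 0)"
      using assms(3)[of x] by (intro exI[of _ t]) (simp add: halted_def)
  qed
  then show ?thesis
    unfolding poly_time_decidable_def by blast
qed

section \<open>Bipartite covers by auction\<close>

text \<open>A matching that saturates the selected vertices, in other words a system of distinct
  representatives.\<close>

definition has_cover :: "('u \<Rightarrow> bool) \<Rightarrow> ('u \<Rightarrow> 'v \<Rightarrow> bool) \<Rightarrow> bool" where
  "has_cover bid adj \<longleftrightarrow> (\<exists>f. inj_on f {u. bid u} \<and> (\<forall>u. bid u \<longrightarrow> adj u (f u)))"

text \<open>
  Array 1 holds the prices of the items and array 2 their owners, shifted by one so that 0 stands
  for an item without owner. A bidder without an item takes a cheapest one among the adjacent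
  items, possibly from another bidder, and raises its price.
\<close>

definition may_bid ::
  "nat \<Rightarrow> (nat \<Rightarrow> bool) \<Rightarrow> (nat \<Rightarrow> nat \<Rightarrow> bool) \<Rightarrow> heap \<Rightarrow> nat \<Rightarrow> nat \<Rightarrow> bool" where
  "may_bid N bid adj h u v \<longleftrightarrow> bid u \<and> adj u v \<and> h 1 v \<le> N \<and>
     (\<forall>w<N. h 2 w \<noteq> Suc u) \<and> (\<forall>w<N. adj u w \<longrightarrow> h 1 v \<le> h 1 w)"

text \<open>Bidders and adjacency are functions of array 0, which records the removed pairs of
  nodes: the matching problem changes in the course of the refinement, but not during one
  auction.\<close>

definition place_bid ::
  "nat \<Rightarrow> ((nat \<Rightarrow> nat) \<Rightarrow> nat \<Rightarrow> bool) \<Rightarrow> ((nat \<Rightarrow> nat) \<Rightarrow> nat \<Rightarrow> nat \<Rightarrow> bool) \<Rightarrow>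
    nat \<Rightarrow> nat \<Rightarrow> heap \<Rightarrow> heap" where
  "place_bid N bid adj u v h =
     (if may_bid N (bid (h 0)) (adj (h 0)) h u v
      then put 2 v (Suc u) (put 1 v (Suc (h 1 v)) h) else h)"

text \<open>The last conjunct is approximate complementary slackness.\<close>

definition auction_inv :: "nat \<Rightarrow> (nat \<Rightarrow> bool) \<Rightarrow> (nat \<Rightarrow> nat \<Rightarrow> bool) \<Rightarrow> heap \<Rightarrow> bool" where
  "auction_inv N bid adj h \<longleftrightarrow>
     (\<forall>v<N. h 1 v \<le> Suc N) \<and>
     (\<forall>v<N. h 1 v > 0 \<longrightarrow> h 2 v > 0) \<and>
     (\<forall>v<N. \<forall>w<N. h 2 v > 0 \<longrightarrow> h 2 v = h 2 w \<longrightarrow> v = w) \<and>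
     (\<forall>v<N. \<forall>u. h 2 v = Suc u \<longrightarrow>
        bid u \<and> adj u v \<and> (\<forall>w<N. adj u w \<longrightarrow> h 1 v \<le> Suc (h 1 w)))"

text \<open>The potential of the auction. Each bid raises it by one, and the cap
  \<open>h 1 v \<le> N\<close> in \<open>may_bid\<close> keeps it bounded.\<close>

definition price_sum :: "nat \<Rightarrow> heap \<Rightarrow> nat" where
  "price_sum N h = (\<Sum>v<N. h 1 v)"

lemma price_sum_le: "auction_inv N bid adj h \<Longrightarrow> price_sum N h \<le> N * Suc N"
  unfolding price_sum_def auction_inv_def
  using sum_bounded_above[of "{..<N}" "h 1" "Suc N"] by simp

text \<open>The new owner pays one more than a least price, which is exactly the slack allowed. For
  the other owners prices elsewhere only rise. Only bidders without an item bid, so nobody owns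
  two.\<close>

lemma place_bid_inv:
  assumes inv: "auction_inv N (bid R) (adj R) h" and "h 0 = R" "v < N"
  shows "auction_inv N (bid R) (adj R) (place_bid N bid adj u v h)"
proof (cases "may_bid N (bid R) (adj R) h u v")
  case True
  then have may: "bid R u" "adj R u v" "h 1 v \<le> N" "\<And>w. w < N \<Longrightarrow> h 2 w \<noteq> Suc u"
    "\<And>w. w < N \<Longrightarrow> adj R u w \<Longrightarrow> h 1 v \<le> h 1 w" by (auto simp: may_bid_def)
  let ?h = "place_bid N bid adj u v h"
  have P: "?h 1 w = (if w = v then Suc (h 1 v) else h 1 w)"
    and O: "?h 2 w = (if w = v then Suc u else h 2 w)" for w
    using True assms by (auto simp: place_bid_def put_def)
  show ?thesis
    unfolding auction_inv_def P O
  proof (intro conjI allI impI)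
    fix w w' assume "w < N" "w' < N"
      "(if w = v then Suc u else h 2 w) > 0"
      "(if w = v then Suc u else h 2 w) = (if w' = v then Suc u else h 2 w')"
    then show "w = w'"
      using inv may(4)[of w] may(4)[of w'] unfolding auction_inv_def by (auto split: if_splits)
  next
    fix w u' assume w: "w < N" "(if w = v then Suc u else h 2 w) = Suc u'"
    show "bid R u'"  "adj R u' w"
      using inv may w unfolding auction_inv_def by (auto split: if_splits)
    fix w' assume w': "w' < N" "adj R u' w'"
    have "h 1 w \<le> Suc (h 1 w')" if "w \<noteq> v"
      using inv w w' that unfolding auction_inv_def by auto
    moreover have "h 1 v \<le> h 1 w'" if "w = v"
      using may(5)[of w'] w w' that by auto
    ultimately show "(if w = v then Suc (h 1 v) else h 1 w) \<le>
        Suc (if w' = v then Suc (h 1 v) else h 1 w')"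
      using w by (cases "w = v"; cases "w' = v") force+
  qed (use inv may in \<open>auto simp: auction_inv_def\<close>)
next
  case False
  then show ?thesis using assms by (simp add: place_bid_def)
qed

lemma place_bid_progress:
  assumes "v < N"
  shows "place_bid N bid adj u v h = h \<and> \<not> may_bid N (bid (h 0)) (adj (h 0)) h u v \<or>
    price_sum N h < price_sum N (place_bid N bid adj u v h)"
proof (cases "may_bid N (bid (h 0)) (adj (h 0)) h u v")
  case True
  have "price_sum N h < price_sum N (put 2 v (Suc u) (put 1 v (Suc (h 1 v)) h))"
    unfolding price_sum_def using assms by (intro sum_strict_mono_ex1) (auto simp: put_def)
  with True show ?thesis by (simp add: place_bid_def)
qed (simp add: place_bid_def)

lemma place_bid_other [simp]: "a \<noteq> 1 \<Longrightarrow> a \<noteq> 2 \<Longrightarrow> place_bid N bid adj u v h a = h a"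
  by (simp add: place_bid_def put_def)

text \<open>The facts \<open>Q\<close> are observed at different moments. If the potential never
  grows, then the state never changes either, and all of them hold in one and the same
  state.\<close>

lemma fold_progress:
  fixes \<mu> :: "'a \<Rightarrow> nat"
  assumes "\<And>k y. k \<in> set ks \<Longrightarrow> I y \<Longrightarrow> I (f k y) \<and> (f k y = y \<and> Q k y \<or> \<mu> y < \<mu> (f k y))" "I y"
  shows "I (fold f ks y) \<and> (fold f ks y = y \<and> (\<forall>k\<in>set ks. Q k y) \<or> \<mu> y < \<mu> (fold f ks y))"
  using assms
proof (induction ks arbitrary: y)
  case (Cons k ks)
  have *: "I (f k y)" "f k y = y \<and> Q k y \<or> \<mu> y < \<mu> (f k y)" using Cons.prems by auto
  have "I (fold f ks (f k y)) \<and> (fold f ks (f k y) = f k y \<and> (\<forall>l\<in>set ks. Q l (f k y)) \<or>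
      \<mu> (f k y) < \<mu> (fold f ks (f k y)))"
    using Cons.IH[of "f k y"] Cons.prems * by simp
  moreover have "I (fold f ks y) \<and> (fold f ks y = y \<and> (\<forall>k\<in>set ks. Q k y) \<or> \<mu> y < \<mu> (fold f ks y))"
    if "f k y = y"
    using Cons.IH[of y] Cons.prems by simp
  ultimately show ?case using * by auto
qed simp

text \<open>Replaces a while loop by a fixed number of rounds: an idle round is followed by idle
  rounds only, and without one the potential is at least the number of rounds, which exceeds its
  bound.\<close>

lemma iterate_until_stuck:
  fixes \<mu> :: "'a \<Rightarrow> nat"
  assumes step: "\<And>y. I y \<Longrightarrow> I (g y) \<and> (g y = y \<and> Q y \<or> \<mu> y < \<mu> (g y))"
    and bound: "\<And>y. I y \<Longrightarrow> \<mu> y \<le> M"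
    and "I y" "M < n"
  shows "I ((g ^^ n) y) \<and> Q ((g ^^ n) y)"
proof -
  have inv: "I ((g ^^ k) y)" for k
    by (induction k) (use step \<open>I y\<close> in auto)
  have "Q ((g ^^ k) y) \<and> g ((g ^^ k) y) = (g ^^ k) y \<or> k \<le> \<mu> ((g ^^ k) y)" for k
  proof (induction k)
    case (Suc k)
    with step[OF inv[of k]] show ?case by auto
  qed simp
  from this[of n] bound[OF inv[of n]] inv[of n] \<open>M < n\<close> show ?thesis by auto
qed

text \<open>
  If a bidder remains without an item, then some price level \<open>j\<close> is empty, and the bidders owning
  the items above this level, together with the unlucky one, violate Hall's condition.
\<close>

lemma auction_stuck_cover:
  assumes inv: "auction_inv N bid adj h"
    and stuck: "\<And>u v. u < N \<Longrightarrow> v < N \<Longrightarrow> \<not> may_bid N bid adj h u v"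
    and bid: "\<And>u. bid u \<Longrightarrow> u < N" and adj: "\<And>u v. adj u v \<Longrightarrow> v < N"
  shows "has_cover bid adj \<longleftrightarrow> (\<forall>u<N. bid u \<longrightarrow> (\<exists>v<N. h 2 v = Suc u))"
proof
  assume all: "\<forall>u<N. bid u \<longrightarrow> (\<exists>v<N. h 2 v = Suc u)"
  define f where "f u = (SOME v. v < N \<and> h 2 v = Suc u)" for u
  have f: "f u < N \<and> h 2 (f u) = Suc u" if "bid u" for u
    using all bid that unfolding f_def by (metis (mono_tags, lifting) someI_ex)
  have "inj_on f {u. bid u}"
    by (rule inj_onI) (metis f mem_Collect_eq nat.inject)
  moreover have "adj u (f u)" if "bid u" for u
    using inv f[OF that] by (auto simp: auction_inv_def)
  ultimately show "has_cover bid adj" unfolding has_cover_def by blast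
next
  assume "has_cover bid adj"
  then obtain f where f: "inj_on f {u. bid u}" "\<And>u. bid u \<Longrightarrow> adj u (f u)"
    unfolding has_cover_def by blast
  show "\<forall>u<N. bid u \<longrightarrow> (\<exists>v<N. h 2 v = Suc u)"
  proof (intro allI impI, rule ccontr)
    fix u assume u: "u < N" "bid u" and no: "\<not> (\<exists>v<N. h 2 v = Suc u)"
    \<comment> \<open>Otherwise a cheapest item adjacent to \<open>u\<close> is below the cap, and
      \<open>u\<close> could still bid for it.\<close>
    have high: "N < h 1 v" if "adj u v" for v
    proof (rule ccontr)
      assume "\<not> N < h 1 v"
      have "\<exists>v. adj u v" using that by blast
      then obtain w where w: "adj u w" "\<And>v. adj u v \<Longrightarrow> h 1 w \<le> h 1 v"
        using ex_has_least_nat[of "adj u" _ "h 1"] by blast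
      with \<open>\<not> N < h 1 v\<close> that have "h 1 w \<le> N" by (meson le_trans linorder_not_less)
      then have "may_bid N bid adj h u w"
        using w no u by (auto simp: may_bid_def)
      then show False using stuck u w adj by blast
    qed
    \<comment> \<open>Pigeonhole: \<open>N\<close> items cannot occupy \<open>N + 1\<close> price
      levels. Levels start at 1 so that every item above the empty level has a positive price and
      hence an owner.\<close>
    have "\<not> {1..Suc N} \<subseteq> h 1 ` {..<N}"
    proof
      assume "{1..Suc N} \<subseteq> h 1 ` {..<N}"
      then have "card {1..Suc N} \<le> card (h 1 ` {..<N})" by (intro card_mono) auto
      also have "\<dots> \<le> N" using card_image_le[of "{..<N}" "h 1"] by simp
      finally show False by simp
    qed
    then obtain j where "j \<in> {1..Suc N}" "j \<notin> h 1 ` {..<N}" by blast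
    then have j: "1 \<le> j" "j \<le> Suc N" "\<And>v. v < N \<Longrightarrow> h 1 v \<noteq> j" by auto
    define T where "T = {v. v < N \<and> j < h 1 v}"
    define W where "W = (\<lambda>v. h 2 v - 1) ` T"
    have owner: "\<exists>w. h 2 v = Suc w" if "v \<in> T" for v
    proof -
      have "h 2 v > 0" using inv that by (auto simp: auction_inv_def T_def)
      then show ?thesis by (rule gr0_implies_Suc)
    qed
    have "finite T" by (simp add: T_def)
    have "inj_on (\<lambda>v. h 2 v - 1) T"
    proof (rule inj_onI)
      fix v w assume vw: "v \<in> T" "w \<in> T" "h 2 v - 1 = h 2 w - 1"
      then have "h 2 v = h 2 w" "h 2 v > 0" using owner[of v] owner[of w] by auto
      then show "v = w" using inv vw by (auto simp: auction_inv_def T_def)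
    qed
    then have cardW: "card W = card T" by (simp add: W_def card_image)
    have uW: "u \<notin> W"
    proof
      assume "u \<in> W"
      then obtain v where v: "v \<in> T" "u = h 2 v - 1" by (auto simp: W_def)
      with owner[of v] no show False by (auto simp: T_def)
    qed
    \<comment> \<open>The owner \<open>w\<close> has an item above level \<open>j\<close>, so by the
      slack of one all its items are priced at least \<open>j\<close>, and no price equals
      \<open>j\<close>.\<close>
    have W: "bid w \<and> f w \<in> T" if "w \<in> W" for w
    proof -
      obtain v where v: "v \<in> T" "w = h 2 v - 1" using \<open>w \<in> W\<close> by (auto simp: W_def)
      with owner[of v] have hv: "h 2 v = Suc w" by auto
      then have "bid w" and le: "\<And>v'. v' < N \<Longrightarrow> adj w v' \<Longrightarrow> h 1 v \<le> Suc (h 1 v')"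
        using inv v(1) hv by (auto simp: auction_inv_def T_def)
      have fw: "adj w (f w)" "f w < N" using f(2)[OF \<open>bid w\<close>] adj by auto
      then show ?thesis using le[of "f w"] v(1) j(3)[of "f w"] \<open>bid w\<close> by (auto simp: T_def)
    qed
    \<comment> \<open>All items of \<open>u\<close> cost at least \<open>N + 1\<close>, hence at
      least \<open>j\<close>, and again not \<open>j\<close> itself. So \<open>f\<close> injects
      \<open>W\<close> and the additional element \<open>u\<close> into \<open>T\<close>, which has
      only as many elements as \<open>W\<close>.\<close>
    have "f u \<in> T"
      using high[OF f(2)[OF u(2)]] j(2) j(3)[of "f u"] adj[OF f(2)[OF u(2)]] by (simp add: T_def)
    moreover have "inj_on f (insert u W)"
      by (rule inj_on_subset[OF f(1)]) (use W u in auto)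
    ultimately have "card (insert u W) \<le> card T"
      using W \<open>finite T\<close> by (intro card_inj_on_le[of f]) auto
    then show False
      using uW cardW \<open>finite T\<close> by (simp add: W_def)
  qed
qed

text \<open>Common to the auction, where it runs over bidders and items, and to the refinement,
  where it runs over pairs of node positions.\<close>

definition sweep :: "nat \<Rightarrow> (nat \<Rightarrow> nat \<Rightarrow> 'a \<Rightarrow> 'a) \<Rightarrow> 'a \<Rightarrow> 'a" where
  "sweep N f = fold (\<lambda>u. fold (f u) [0..<N]) [0..<N]"

lemma sweep_progress:
  fixes \<mu> :: "'a \<Rightarrow> nat"
  assumes "\<And>u v y. u < N \<Longrightarrow> v < N \<Longrightarrow> I y \<Longrightarrow>
      I (f u v y) \<and> (f u v y = y \<and> Q u v y \<or> \<mu> y < \<mu> (f u v y))" "I y"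
  shows "I (sweep N f y) \<and>
    (sweep N f y = y \<and> (\<forall>u<N. \<forall>v<N. Q u v y) \<or> \<mu> y < \<mu> (sweep N f y))"
proof -
  have "I (sweep N f y) \<and> (sweep N f y = y \<and> (\<forall>u\<in>set [0..<N]. \<forall>v\<in>set [0..<N]. Q u v y) \<or>
      \<mu> y < \<mu> (sweep N f y))"
    unfolding sweep_def
    by (rule fold_progress[where Q = "\<lambda>u y. \<forall>v\<in>set [0..<N]. Q u v y"], rule fold_progress)
      (use assms in auto)
  then show ?thesis by (simp add: Ball_def)
qed

definition empty_auction :: "nat \<Rightarrow> heap \<Rightarrow> heap" where
  "empty_auction N h = fold (\<lambda>v h. put 2 v 0 (put 1 v 0 h)) [0..<N] h"

lemma empty_auction_other: "a \<noteq> 1 \<Longrightarrow> a \<noteq> 2 \<Longrightarrow> empty_auction N h a = h a"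
  unfolding empty_auction_def by (induction N) (auto simp: put_def)

lemma empty_auction_eq_0: "v < N \<Longrightarrow> empty_auction N h 1 v = 0 \<and> empty_auction N h 2 v = 0"
  unfolding empty_auction_def by (induction N) (auto simp: put_def less_Suc_eq)

text \<open>Prices are at most \<open>N + 1\<close>, so their sum is at most
  \<open>N * (N + 1)\<close>. For \<open>3 \<le> N\<close> this is less than the number of sweeps,
  and each sweep that changes the state raises the sum.\<close>

definition auction ::
  "nat \<Rightarrow> ((nat \<Rightarrow> nat) \<Rightarrow> nat \<Rightarrow> bool) \<Rightarrow> ((nat \<Rightarrow> nat) \<Rightarrow> nat \<Rightarrow> nat \<Rightarrow> bool) \<Rightarrow> heap \<Rightarrow> heap" where
  "auction N bid adj h = (sweep N (place_bid N bid adj) ^^ (N * (N * N))) (empty_auction N h)"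

lemma auction_correct:
  assumes "3 \<le> N" and bid: "\<And>u. bid (h 0) u \<Longrightarrow> u < N" and adj: "\<And>u v. adj (h 0) u v \<Longrightarrow> v < N"
  shows "(\<forall>u<N. bid (h 0) u \<longrightarrow> (\<exists>v<N. auction N bid adj h 2 v = Suc u)) \<longleftrightarrow>
           has_cover (bid (h 0)) (adj (h 0))"
    and "auction N bid adj h 0 = h 0"
proof -
  let ?I = "\<lambda>g. g 0 = h 0 \<and> auction_inv N (bid (h 0)) (adj (h 0)) g"
  let ?Q = "\<lambda>g. \<forall>u<N. \<forall>v<N. \<not> may_bid N (bid (g 0)) (adj (g 0)) g u v"
  have "?I (auction N bid adj h) \<and> ?Q (auction N bid adj h)"
    unfolding auction_def
  proof (rule iterate_until_stuck[where \<mu> = "price_sum N" and M = "N * Suc N"])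
    fix g assume "?I g"
    then show "?I (sweep N (place_bid N bid adj) g) \<and>
      (sweep N (place_bid N bid adj) g = g \<and> ?Q g \<or>
       price_sum N g < price_sum N (sweep N (place_bid N bid adj) g))"
    proof (intro sweep_progress)
      fix u v y assume "u < N" "v < N" "?I y"
      then show "?I (place_bid N bid adj u v y) \<and>
          (place_bid N bid adj u v y = y \<and> \<not> may_bid N (bid (y 0)) (adj (y 0)) y u v \<or>
           price_sum N y < price_sum N (place_bid N bid adj u v y))"
        using place_bid_inv[of N bid "h 0" adj y v u] place_bid_progress[of v N bid adj u y] by auto
    qed (use \<open>?I g\<close> in simp)
  next
    show "?I (empty_auction N h)"
      by (auto simp: auction_inv_def empty_auction_eq_0 empty_auction_other simp del: One_nat_def)
    have "Suc N < N * N" using \<open>3 \<le> N\<close> mult_le_mono1[of 3 N N] by linarith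
    then show "N * Suc N < N * (N * N)" using \<open>3 \<le> N\<close> by (intro mult_strict_left_mono) auto
  qed (use price_sum_le in blast)
  then show "(\<forall>u<N. bid (h 0) u \<longrightarrow> (\<exists>v<N. auction N bid adj h 2 v = Suc u)) \<longleftrightarrow>
           has_cover (bid (h 0)) (adj (h 0))" "auction N bid adj h 0 = h 0"
    using auction_stuck_cover[of N "bid (h 0)" "adj (h 0)" "auction N bid adj h"] bid adj by auto
qed

section \<open>The local condition as a pair of covers\<close>

text \<open>A proper interval is nonempty, so its end points witness a failing inclusion; an
  unbounded one contains numbers beyond any finite bound.\<close>

lemma interval_set_subset_iff:
  assumes "is_interval I"
  shows "interval_set I \<subseteq> interval_set J \<longleftrightarrow> fst J \<le> fst I \<and> snd I \<le> snd J"
proof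
  assume sub: "interval_set I \<subseteq> interval_set J"
  have "fst I \<in> interval_set I" using assms by (simp add: interval_set_def is_interval_def)
  then have fst: "fst J \<le> fst I" using sub by (auto simp: interval_set_def)
  have "snd I \<le> snd J"
  proof (cases "snd I")
    case (enat k)
    then have "k \<in> interval_set I" using assms by (simp add: interval_set_def is_interval_def)
    then show ?thesis using sub enat by (auto simp: interval_set_def)
  next
    case infinity
    show ?thesis
    proof (cases "snd J")
      case (enat k)
      have "max (fst I) (Suc k) \<in> interval_set I" using infinity by (simp add: interval_set_def)
      then have "max (fst I) (Suc k) \<in> interval_set J" using sub by blast
      then show ?thesis using enat by (auto simp: interval_set_def)
    qed simp
  qed
  with fst show "fst J \<le> fst I \<and> snd I \<le> snd J" by blast
next
  assume "fst J \<le> fst I \<and> snd I \<le> snd J"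
  then show "interval_set I \<subseteq> interval_set J"
    by (auto simp: interval_set_def intro: order_trans)
qed

lemma is_interval_sum:
  assumes "\<And>e. e \<in> A \<Longrightarrow> is_interval (g e)"
  shows "is_interval (\<Sum>e\<in>A. g e)"
  using assms
proof (induction A rule: infinite_finite_induct)
  case (insert a A)
  then have "enat (fst (g a)) + enat (fst (sum g A)) \<le> snd (g a) + snd (sum g A)"
    by (intro add_mono) (auto simp: is_interval_def)
  with insert show ?case by (simp add: is_interval_def)
qed (auto simp: is_interval_def zero_prod_def zero_enat_def)

text \<open>
  The theorem of Mendelsohn and Dulmage, by Banach's decomposition argument: \<open>A\<close> is the least set
  of bidders that contains those outside the range of \<open>g\<close> and is closed under \<open>g \<circ> f\<close>. The
  matching follows \<open>f\<close> on \<open>A\<close> and \<open>g\<close> elsewhere.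
\<close>

lemma mendelsohn_dulmage:
  assumes f: "inj_on f X" "\<And>u. u \<in> X \<Longrightarrow> adj u (f u)"
    and g: "inj_on g Y" "\<And>v. v \<in> Y \<Longrightarrow> adj (g v) v"
  shows "\<exists>M. (\<forall>(u, v)\<in>M. adj u v) \<and> single_valued M \<and> single_valued (M\<inverse>) \<and>
           X \<subseteq> Domain M \<and> Y \<subseteq> Range M"
proof -
  define F where "F S = (X - g ` Y) \<union> {g (f u) |u. u \<in> S \<and> u \<in> X \<and> f u \<in> Y \<and> g (f u) \<in> X}" for S
  define A where "A = lfp F"
  have "mono F" unfolding F_def by (auto intro!: monoI)
  then have A: "A = F A" unfolding A_def by (rule lfp_unfold)
  have AX: "A \<subseteq> X" by (subst A) (auto simp: F_def)
  define M where "M = {(u, f u) |u. u \<in> A} \<union> {(g v, v) |v. v \<in> Y \<and> v \<notin> f ` A}"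
  \<comment> \<open>Separates the two halves of \<open>M\<close> on the left. On the right they are
    separated by definition.\<close>
  have gA: "g v \<notin> A" if v: "v \<in> Y" "v \<notin> f ` A" for v
  proof
    assume "g v \<in> A"
    then have "g v \<in> F A" using A by simp
    then obtain u where "u \<in> A" "f u \<in> Y" "g v = g (f u)" using v by (auto simp: F_def)
    then show False using v g(1) by (auto dest: inj_onD)
  qed
  have "\<forall>(u, v)\<in>M. adj u v"
    using f(2) g(2) AX by (auto simp: M_def)
  moreover have "single_valued M"
    unfolding single_valued_def using gA g(1) by (auto simp: M_def dest: inj_onD)
  moreover have "single_valued (M\<inverse>)"
    unfolding single_valued_def using AX f(1) by (auto simp: M_def dest!: inj_onD)
  moreover have "X \<subseteq> Domain M"
  proof
    fix u assume u: "u \<in> X"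
    show "u \<in> Domain M"
    proof (cases "u \<in> A")
      case False
      then have "u \<notin> F A" using A by simp
      then obtain v where v: "v \<in> Y" "u = g v" using u by (auto simp: F_def)
      have "v \<notin> f ` A"
      proof
        assume "v \<in> f ` A"
        then have "g v \<in> F A" using v u AX by (auto simp: F_def)
        then show False using \<open>u \<notin> F A\<close> v by simp
      qed
      then show ?thesis using v by (auto simp: M_def)
    qed (auto simp: M_def)
  qed
  moreover have "Y \<subseteq> Range M"
  proof
    fix v assume "v \<in> Y"
    then show "v \<in> Range M" by (cases "v \<in> f ` A") (auto simp: M_def)
  qed
  ultimately show ?thesis by blast
qed

text \<open>
  The edges that have to be matched are, on the left, those without an admissible target of
  unbounded multiplicity and, on the right, the mandatory ones. All other edges of the left side
  can be sent to a target of unbounded multiplicity.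
\<close>

lemma local_condition_iff_covers:
  fixes oc :: "'e \<Rightarrow> interval" and oc' :: "'f \<Rightarrow> interval"
    and ok :: "'e \<Rightarrow> 'f \<Rightarrow> bool"
  assumes fin: "finite E"
    and basic: "\<And>e. e \<in> E \<Longrightarrow> oc e \<in> basic_intervals" "\<And>f. f \<in> F \<Longrightarrow> oc' f \<in> basic_intervals"
  defines "adj \<equiv> \<lambda>e f. e \<in> E \<and> f \<in> F \<and> ok e f \<and> fst (oc' f) \<le> fst (oc e) \<and> snd (oc e) \<le> snd (oc' f)"
  shows "(\<exists>h. h ` E \<subseteq> F \<and> (\<forall>e\<in>E. ok e (h e)) \<and>
            (\<forall>f\<in>F. interval_set (\<Sum>e\<in>{e \<in> E. h e = f}. oc e) \<subseteq> interval_set (oc' f))) \<longleftrightarrow>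
         has_cover (\<lambda>e. e \<in> E \<and> \<not> (\<exists>f\<in>F. ok e f \<and> snd (oc' f) = \<infinity>)) adj \<and>
         has_cover (\<lambda>f. f \<in> F \<and> fst (oc' f) > 0) (\<lambda>f e. adj e f)"
    (is "?L \<longleftrightarrow> ?R1 \<and> ?R2")
proof
  have int: "is_interval (oc e)" if "e \<in> E" for e
    using basic(1)[OF that] by (auto simp: basic_intervals_def is_interval_def one_enat_def)
  have snd1: "1 \<le> snd (oc e)" if "e \<in> E" for e
    using basic(1)[OF that] by (auto simp: basic_intervals_def)
  have sub_iff: "interval_set (\<Sum>e\<in>D. oc e) \<subseteq> interval_set (oc' f) \<longleftrightarrow>
      fst (oc' f) \<le> (\<Sum>e\<in>D. fst (oc e)) \<and> (\<Sum>e\<in>D. snd (oc e)) \<le> snd (oc' f)" if "D \<subseteq> E" for D f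
    using that int by (subst interval_set_subset_iff[OF is_interval_sum]) (auto simp: fst_sum snd_sum)
  {
    assume ?L
    then obtain h where h: "h ` E \<subseteq> F" "\<And>e. e \<in> E \<Longrightarrow> ok e (h e)"
      "\<And>f. f \<in> F \<Longrightarrow> interval_set (\<Sum>e\<in>{e \<in> E. h e = f}. oc e) \<subseteq> interval_set (oc' f)"
      by blast
    have lower: "fst (oc' f) \<le> (\<Sum>e\<in>{e \<in> E. h e = f}. fst (oc e))"
      and upper: "(\<Sum>e\<in>{e \<in> E. h e = f}. snd (oc e)) \<le> snd (oc' f)" if "f \<in> F" for f
      using h(3)[OF that] sub_iff[of "{e \<in> E. h e = f}" f] by blast+
    \<comment> \<open>A basic interval has upper bound at least 1, and a finite one has upper bound
      exactly 1; two edges sent to such a target would already add up to 2.\<close>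
    have single: "{e' \<in> E. h e' = h e} = {e}" if e: "e \<in> E" "snd (oc' (h e)) \<noteq> \<infinity>" for e
    proof (rule ccontr)
      let ?D = "{e' \<in> E. h e' = h e}"
      assume "?D \<noteq> {e}"
      then obtain e' where e': "e' \<in> ?D" "e' \<noteq> e" using e by blast
      have "oc' (h e) \<in> basic_intervals" using basic(2) h(1) e by blast
      then have "snd (oc' (h e)) = 1" using e(2) by (auto simp: basic_intervals_def)
      have "2 = (\<Sum>e\<in>{e, e'}. 1 :: enat)" using e' by (simp add: one_add_one)
      also have "\<dots> \<le> (\<Sum>e\<in>{e, e'}. snd (oc e))" using snd1 e e' by (intro sum_mono) auto
      also have "\<dots> \<le> (\<Sum>e\<in>?D. snd (oc e))" using fin e e' by (intro sum_mono2) auto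
      also have "\<dots> \<le> 1" using upper[of "h e"] h(1) e \<open>snd (oc' (h e)) = 1\<close> by auto
      finally show False by (simp add: one_enat_def numeral_eq_enat)
    qed
    \<comment> \<open>The sum has the single summand of \<open>e\<close>, so the inclusion for the
      target is the inclusion for \<open>e\<close> alone.\<close>
    have fits: "adj e (h e)" if e: "e \<in> E" "snd (oc' (h e)) \<noteq> \<infinity>" for e
      using lower[of "h e"] upper[of "h e"] single[OF e] e h by (auto simp: adj_def)
    let ?X = "{e \<in> E. \<not> (\<exists>f\<in>F. ok e f \<and> snd (oc' f) = \<infinity>)}"
    have X: "snd (oc' (h e)) \<noteq> \<infinity>" if "e \<in> ?X" for e using that h by auto
    have "inj_on h ?X"
    proof (rule inj_onI)
      fix e e' assume e: "e \<in> ?X" "e' \<in> ?X" "h e = h e'"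
      then have "e' \<in> {e' \<in> E. h e' = h e}" by simp
      also have "\<dots> = {e}" using X[OF e(1)] e(1) by (intro single) auto
      finally show "e = e'" by simp
    qed
    then have ?R1
      unfolding has_cover_def using fits X by (intro exI[of _ h]) auto
    define g where "g f = (SOME e. e \<in> E \<and> h e = f \<and> adj e f)" for f
    have g: "g f \<in> E \<and> h (g f) = f \<and> adj (g f) f" if f: "f \<in> F" "fst (oc' f) > 0" for f
    proof -
      \<comment> \<open>A positive lower bound of the sum requires a summand with lower bound 1. For
        a target of unbounded multiplicity this summand already fits; for a bounded target it is the
        only one.\<close>
      have "(\<Sum>e\<in>{e \<in> E. h e = f}. fst (oc e)) \<noteq> 0" using lower[OF f(1)] f(2) by linarith
      then obtain e where e: "e \<in> E" "h e = f" "fst (oc e) \<noteq> 0"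
        by (metis (mono_tags, lifting) mem_Collect_eq sum.neutral)
      have "adj e f"
      proof (cases "snd (oc' f) = \<infinity>")
        case True
        then show ?thesis using e f basic(2)[OF f(1)] h by (auto simp: adj_def basic_intervals_def)
      qed (use fits e in auto)
      with e have "\<exists>e. e \<in> E \<and> h e = f \<and> adj e f" by blast
      then show ?thesis unfolding g_def by (rule someI_ex)
    qed
    have "inj_on g {f \<in> F. fst (oc' f) > 0}"
      by (rule inj_on_inverseI[of _ h]) (use g in auto)
    then have ?R2
      unfolding has_cover_def using g by (intro exI[of _ g]) auto
    with \<open>?R1\<close> show "?R1 \<and> ?R2" by blast
  }
  assume "?R1 \<and> ?R2"
  let ?X = "{e. e \<in> E \<and> \<not> (\<exists>f\<in>F. ok e f \<and> snd (oc' f) = \<infinity>)}"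
  let ?Y = "{f. f \<in> F \<and> fst (oc' f) > 0}"
  obtain a where a: "inj_on a ?X" "\<And>e. e \<in> ?X \<Longrightarrow> adj e (a e)"
    using \<open>?R1 \<and> ?R2\<close> unfolding has_cover_def by blast
  obtain b where b: "inj_on b ?Y" "\<And>f. f \<in> ?Y \<Longrightarrow> adj (b f) f"
    using \<open>?R1 \<and> ?R2\<close> unfolding has_cover_def by blast
  have "\<exists>M. (\<forall>(e, f)\<in>M. adj e f) \<and> single_valued M \<and> single_valued (M\<inverse>) \<and>
      ?X \<subseteq> Domain M \<and> ?Y \<subseteq> Range M"
    by (rule mendelsohn_dulmage[of a ?X adj b ?Y]) (fact a b)+
  then obtain M where match: "\<forall>(e, f)\<in>M. adj e f" "single_valued M" "single_valued (M\<inverse>)"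
    "?X \<subseteq> Domain M" "?Y \<subseteq> Range M"
    by (elim exE conjE)
  have M1: "adj e f" if "(e, f) \<in> M" for e f
    using match(1) that by blast
  have M2: "f = f'" if "(e, f) \<in> M" "(e, f') \<in> M" for e f f'
    using match(2) that by (rule single_valuedD)
  have M3: "e = e'" if "(e, f) \<in> M" "(e', f) \<in> M" for e e' f
    using single_valuedD[OF match(3), of f e e'] that by simp
  have M4: "\<exists>f. (e, f) \<in> M" if "e \<in> ?X" for e
    using match(4) that by (meson DomainE subsetD)
  have M5: "\<exists>e. (e, f) \<in> M" if "f \<in> ?Y" for f
    using match(5) that by (meson RangeE subsetD)
  \<comment> \<open>A matched edge follows the matching. Any other edge goes to some admissible
    target of unbounded multiplicity; one exists, since \<open>M\<close> covers all edges without
    such a target.\<close>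
  define P where "P e f \<longleftrightarrow> (e, f) \<in> M \<or> (\<nexists>f. (e, f) \<in> M) \<and> f \<in> F \<and> ok e f \<and> snd (oc' f) = \<infinity>" for e f
  define h where "h e = (SOME f. P e f)" for e
  have P: "P e (h e)" if "e \<in> E" for e
  proof -
    have "\<exists>f. P e f" using M4[of e] that unfolding P_def by blast
    then show ?thesis unfolding h_def by (rule someI_ex)
  qed
  have hM: "h e = f" if "(e, f) \<in> M" for e f
  proof -
    have "e \<in> E" using M1[OF that] by (simp add: adj_def)
    then have "(e, h e) \<in> M" using P[of e] that unfolding P_def by blast
    then show ?thesis using M2 that by blast
  qed
  have hF: "h e \<in> F \<and> ok e (h e)" if "e \<in> E" for e
    using P[OF that] M1[of e "h e"] unfolding P_def adj_def by blast
  have "interval_set (\<Sum>e\<in>{e \<in> E. h e = f}. oc e) \<subseteq> interval_set (oc' f)" if f: "f \<in> F" for f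
  proof -
    let ?D = "{e \<in> E. h e = f}"
    have "fst (oc' f) \<le> (\<Sum>e\<in>?D. fst (oc e)) \<and> (\<Sum>e\<in>?D. snd (oc e)) \<le> snd (oc' f)"
    \<comment> \<open>If \<open>f\<close> is matched, its partner alone supplies the lower bound,
      and if \<open>f\<close> is bounded nothing else is sent there. If \<open>f\<close> is
      unmatched, it is not mandatory, and it receives edges only if it is unbounded.\<close>
    proof (cases "\<exists>e. (e, f) \<in> M")
      case True
      then obtain e where e: "(e, f) \<in> M" by blast
      then have a: "adj e f" "h e = f" using M1 hM by auto
      then have eD: "e \<in> ?D" by (simp add: adj_def)
      have "fst (oc' f) \<le> fst (oc e)" using a by (simp add: adj_def)
      also have "\<dots> \<le> (\<Sum>e\<in>?D. fst (oc e))" using fin eD by (intro member_le_sum) auto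
      finally have lo: "fst (oc' f) \<le> (\<Sum>e\<in>?D. fst (oc e))" .
      show ?thesis
      proof (cases "snd (oc' f) = \<infinity>")
        case False
        have "?D \<subseteq> {e}"
        proof
          fix e' assume "e' \<in> ?D"
          then have "(e', f) \<in> M" using P[of e'] False by (auto simp: P_def)
          then show "e' \<in> {e}" using M3 e by blast
        qed
        then have "?D = {e}" using eD by blast
        then show ?thesis using a by (simp add: adj_def)
      qed (use lo in simp)
    next
      case False
      then have "fst (oc' f) = 0" using M5[of f] f by auto
      moreover have "(\<Sum>e\<in>?D. snd (oc e)) \<le> snd (oc' f)"
      proof (cases "snd (oc' f) = \<infinity>")
        case fin: False
        have "?D = {}"
        proof -
          have "h e \<noteq> f" if "e \<in> E" for e using P[OF that] False fin by (auto simp: P_def)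
          then show ?thesis by blast
        qed
        then show ?thesis by (simp only: sum.empty zero_le)
      qed simp
      ultimately show ?thesis by simp
    qed
    then show ?thesis by (subst sub_iff) auto
  qed
  then show ?L using hF by blast
qed

section \<open>Decoding the input\<close>

definition num_nodes :: "nat list \<Rightarrow> nat \<Rightarrow> nat" where
  "num_nodes x p = input_at x p"

definition node_at :: "nat list \<Rightarrow> nat \<Rightarrow> nat \<Rightarrow> nat" where
  "node_at x p i = input_at x (p + 1 + i)"

definition num_edges :: "nat list \<Rightarrow> nat \<Rightarrow> nat" where
  "num_edges x p = input_at x (p + 1 + num_nodes x p)"

text \<open>The fields \<open>k\<close> are source, target, label, lower and upper bound, in this
  order. The offset 2 accounts for the two length fields.\<close>

definition edge_entry :: "nat list \<Rightarrow> nat \<Rightarrow> nat \<Rightarrow> nat \<Rightarrow> nat" where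
  "edge_entry x p e k = input_at x (p + 2 + num_nodes x p + 5 * e + k)"

definition graph_length :: "nat list \<Rightarrow> nat \<Rightarrow> nat" where
  "graph_length x p = 2 + num_nodes x p + 5 * num_edges x p"

abbreviation second :: "nat list \<Rightarrow> nat" where
  "second x \<equiv> graph_length x 0"

fun decode_interval :: "nat \<times> nat \<Rightarrow> interval" where
  "decode_interval (l, u) = (l, if u = 0 then \<infinity> else enat (u - 1))"

text \<open>Nodes keep their names, while an edge becomes its position in the list, because the code
  of a graph does not contain the names of its edges.\<close>

definition decode :: "'l set \<Rightarrow> ('l \<Rightarrow> nat) \<Rightarrow> nat list \<Rightarrow> nat \<Rightarrow> (nat, nat, 'l) graph" where
  "decode \<Sigma> \<kappa> x p =
     \<lparr>nodes = node_at x p ` {..<num_nodes x p}, edges = {..<num_edges x p},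
      source = (\<lambda>e. edge_entry x p e 0), target = (\<lambda>e. edge_entry x p e 1),
      lab = (\<lambda>e. inv_into \<Sigma> \<kappa> (edge_entry x p e 2)),
      occur = (\<lambda>e. decode_interval (edge_entry x p e 3, edge_entry x p e 4))\<rparr>"

text \<open>The tests on the fields 3 and 4 single out the basic intervals: the upper bound 1 is
  written as 2 and infinity as 0. Injectivity of \<open>node_at\<close> expresses that the list of
  nodes is distinct.\<close>

definition valid_graph :: "nat set \<Rightarrow> nat list \<Rightarrow> nat \<Rightarrow> bool" where
  "valid_graph K x p \<longleftrightarrow> inj_on (node_at x p) {..<num_nodes x p} \<and>
     (\<forall>e<num_edges x p.
        edge_entry x p e 0 \<in> node_at x p ` {..<num_nodes x p} \<and>
        edge_entry x p e 1 \<in> node_at x p ` {..<num_nodes x p} \<and>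
        edge_entry x p e 2 \<in> K \<and> edge_entry x p e 3 < 2 \<and>
        (edge_entry x p e 4 = 0 \<or> edge_entry x p e 4 = 2))"

definition valid_input :: "nat set \<Rightarrow> nat list \<Rightarrow> bool" where
  "valid_input K x \<longleftrightarrow> second x + graph_length x (second x) = length x \<and>
     valid_graph K x 0 \<and> valid_graph K x (second x)"

lemma decode_interval_basic_iff:
  "decode_interval (l, u) \<in> basic_intervals \<longleftrightarrow> l < 2 \<and> (u = 0 \<or> u = 2)"
  by (cases u) (auto simp: basic_intervals_def one_enat_def)

lemma encode_decode_interval: "encode_interval (decode_interval (l, u)) = [l, u]"
  by (cases u) auto

lemma decode_encode_interval:
  "encode_interval I = [l, u] \<Longrightarrow> decode_interval (l, u) = I"
  by (cases I) (auto split: enat.splits)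

lemma is_interval_basic: "I \<in> basic_intervals \<Longrightarrow> is_interval I"
  by (auto simp: basic_intervals_def is_interval_def one_enat_def)

lemma shape_graph_decode: "valid_graph (\<kappa> ` \<Sigma>) x p \<Longrightarrow> shape_graph \<Sigma> (decode \<Sigma> \<kappa> x p)"
  unfolding shape_graph_def is_graph_def valid_graph_def decode_def
  using decode_interval_basic_iff is_interval_basic
  by (auto intro: inv_into_into simp del: decode_interval.simps)

lemma concat_chunks:
  "concat (map (\<lambda>e. map (\<lambda>k. f (5 * e + k)) [0..<5]) [0..<m]) = map f [0..<5 * m]"
proof (induction m)
  case (Suc m)
  have "map (\<lambda>k. f (5 * m + k)) [0..<5] = map f [5 * m..<5 * m + 5]"
    by (simp add: map_add_upt[symmetric, of "5 * m"] add.commute comp_def del: map_add_upt)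
  moreover have "[0..<5 * Suc m] = [0..<5 * m] @ [5 * m..<5 * m + 5]"
    using upt_add_eq_append[of 0 "5 * m" 5] by (simp add: add.commute)
  ultimately show ?case using Suc by simp
qed simp

lemma concat_map_nth:
  assumes "\<And>e. length (f e) = 5" "e < length es" "k < 5"
  shows "concat (map f es) ! (5 * e + k) = f (es ! e) ! k"
  using assms(2)
proof (induction es arbitrary: e)
  case (Cons a es)
  then show ?case
    using assms(1,3) by (cases e) (auto simp: nth_append)
qed simp

lemma length_concat_map:
  "(\<And>e. length (f e) = 5) \<Longrightarrow> length (concat (map f es)) = 5 * length es"
  by (induction es) auto

lemma length_encode_edge: "length (encode_edge \<kappa> G e) = 5"
  by (cases "occur G e") (simp add: encode_edge_def)

lemma encodes_decode:
  assumes valid: "valid_graph (\<kappa> ` \<Sigma>) x p" and len: "p + graph_length x p \<le> length x"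
  shows "encodes \<kappa> (take (graph_length x p) (drop p x)) (decode \<Sigma> \<kappa> x p)"
proof -
  let ?n = "num_nodes x p" and ?m = "num_edges x p"
  let ?G = "decode \<Sigma> \<kappa> x p"
  define ns where "ns = map (node_at x p) [0..<?n]"
  have edge: "encode_edge \<kappa> ?G e = map (\<lambda>k. input_at x (p + 2 + ?n + (5 * e + k))) [0..<5]"
    if "e < ?m" for e
  proof -
    have "edge_entry x p e 2 \<in> \<kappa> ` \<Sigma>" using that valid by (auto simp: valid_graph_def)
    then have "encode_edge \<kappa> ?G e = map (edge_entry x p e) [0, 1, 2, 3, 4]"
      by (simp add: encode_edge_def decode_def f_inv_into_f encode_decode_interval
          del: decode_interval.simps)
    also have "[0, 1, 2, 3, 4] = [0..<5::nat]" by (simp add: upt_rec)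
    finally show ?thesis by (simp only: edge_entry_def add.assoc)
  qed
  have "concat (map (encode_edge \<kappa> ?G) [0..<?m]) =
      concat (map (\<lambda>e. map (\<lambda>k. input_at x (p + 2 + ?n + (5 * e + k))) [0..<5]) [0..<?m])"
    using edge by (intro arg_cong[of _ _ concat] map_cong) auto
  also have "\<dots> = map (\<lambda>i. input_at x (p + 2 + ?n + i)) [0..<5 * ?m]"
    by (rule concat_chunks)
  finally have es: "concat (map (encode_edge \<kappa> ?G) [0..<?m]) = \<dots>" .
  have "take (graph_length x p) (drop p x) =
      length ns # ns @ length [0..<?m] # concat (map (encode_edge \<kappa> ?G) [0..<?m])" (is "_ = ?w")
  proof (rule nth_equalityI)
    show "length (take (graph_length x p) (drop p x)) = length ?w"
      using len by (simp add: es ns_def graph_length_def)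
    fix i assume "i < length (take (graph_length x p) (drop p x))"
    then have i: "i < graph_length x p" by simp
    then have "take (graph_length x p) (drop p x) ! i = input_at x (p + i)"
      using len by (simp add: input_at_def)
    also have "\<dots> = ?w ! i"
    proof -
      consider "i = 0" | j where "i = Suc j" "j < ?n" | "i = Suc ?n" | j where "i = Suc (Suc (?n + j))"
        "j < 5 * ?m"
      proof -
        have "i = 0 \<or> (\<exists>j. i = Suc j \<and> j < ?n) \<or> i = Suc ?n \<or> (\<exists>j. i = Suc (Suc (?n + j)) \<and> j < 5 * ?m)"
          using i unfolding graph_length_def by presburger
        then show ?thesis using that by blast
      qed
      then show ?thesis
      proof cases
        case 4
        then show ?thesis by (simp add: es ns_def nth_append add.assoc)
      qed (simp_all add: ns_def nth_append node_at_def num_nodes_def num_edges_def)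
    qed
    finally show "take (graph_length x p) (drop p x) ! i = ?w ! i" .
  qed
  moreover have "distinct ns" "set ns = nodes ?G"
    using valid by (auto simp: ns_def valid_graph_def decode_def distinct_map atLeast0LessThan)
  ultimately show ?thesis
    unfolding encodes_def
    by (intro exI[of _ ns] exI[of _ "[0..<?m]"]) (simp add: decode_def atLeast0LessThan)
qed

section \<open>Invariance under renaming of edges\<close>

definition edge_renaming :: "('e' \<Rightarrow> 'e) \<Rightarrow> ('n, 'e', 'l) graph \<Rightarrow> ('n, 'e, 'l) graph \<Rightarrow> bool" where
  "edge_renaming \<phi> G' G \<longleftrightarrow> nodes G' = nodes G \<and> bij_betw \<phi> (edges G') (edges G) \<and>
     (\<forall>e\<in>edges G'. source G' e = source G (\<phi> e) \<and> target G' e = target G (\<phi> e) \<and>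
        lab G' e = lab G (\<phi> e) \<and> occur G' e = occur G (\<phi> e))"

lemma edge_renaming_out:
  assumes "edge_renaming \<phi> G' G"
  shows "bij_betw \<phi> (out G' n) (out G n)"
  unfolding bij_betw_def
proof
  show "inj_on \<phi> (out G' n)"
    using assms by (auto simp: edge_renaming_def bij_betw_def out_def intro: inj_on_subset)
  show "\<phi> ` out G' n = out G n"
  proof
    show "\<phi> ` out G' n \<subseteq> out G n"
      using assms by (auto simp: edge_renaming_def bij_betw_def out_def)
    show "out G n \<subseteq> \<phi> ` out G' n"
    proof
      fix e assume e: "e \<in> out G n"
      have "e \<in> \<phi> ` edges G'" using e assms by (simp add: edge_renaming_def bij_betw_def out_def)
      then obtain e' where "e' \<in> edges G'" "e = \<phi> e'" by blast
      with e assms show "e \<in> \<phi> ` out G' n" by (auto simp: edge_renaming_def out_def)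
    qed
  qed
qed

definition local_match ::
  "('n, 'e, 'l) graph \<Rightarrow> ('m, 'f, 'l) graph \<Rightarrow> ('n \<times> 'm) set \<Rightarrow> 'n \<Rightarrow> 'm \<Rightarrow> bool" where
  "local_match G H R n m \<longleftrightarrow> (\<exists>h. h ` out G n \<subseteq> out H m \<and>
     (\<forall>e\<in>out G n. lab G e = lab H (h e) \<and> (target G e, target H (h e)) \<in> R) \<and>
     (\<forall>f\<in>out H m.
        interval_set (\<Sum>e\<in>{e \<in> out G n. h e = f}. occur G e) \<subseteq> interval_set (occur H f)))"

lemma simulation_iff_local_match:
  "simulation G H R \<longleftrightarrow> R \<subseteq> nodes G \<times> nodes H \<and> (\<forall>n m. (n, m) \<in> R \<longrightarrow> local_match G H R n m)"
  unfolding simulation_def local_match_def by auto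

text \<open>The relation on nodes is unchanged; the function between outgoing edges is conjugated
  with the two bijections, under which its fibres, and hence the interval sums, correspond.\<close>

lemma simulation_edge_renaming:
  assumes G: "edge_renaming \<phi> G' G" and H: "edge_renaming \<psi> H' H" and sim: "simulation G H R"
  shows "simulation G' H' R"
  unfolding simulation_iff_local_match
proof (intro conjI allI impI)
  show "R \<subseteq> nodes G' \<times> nodes H'"
    using assms by (simp add: simulation_def edge_renaming_def)
next
  fix n m assume "(n, m) \<in> R"
  then have "local_match G H R n m" using sim by (simp add: simulation_iff_local_match)
  then obtain h where h: "h ` out G n \<subseteq> out H m"
    "\<And>e. e \<in> out G n \<Longrightarrow> lab G e = lab H (h e) \<and> (target G e, target H (h e)) \<in> R"
    "\<And>f. f \<in> out H m \<Longrightarrow>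
       interval_set (\<Sum>e\<in>{e \<in> out G n. h e = f}. occur G e) \<subseteq> interval_set (occur H f)"
    unfolding local_match_def by blast
  note \<phi> = edge_renaming_out[OF G, of n] and \<psi> = edge_renaming_out[OF H, of m]
  define h' where "h' = (\<lambda>e. inv_into (out H' m) \<psi> (h (\<phi> e)))"
  have \<phi>_in: "\<phi> e \<in> out G n" if "e \<in> out G' n" for e
    using \<phi> that by (auto simp: bij_betw_def)
  have h': "h' e \<in> out H' m \<and> \<psi> (h' e) = h (\<phi> e)" if "e \<in> out G' n" for e
  proof -
    have "h (\<phi> e) \<in> \<psi> ` out H' m" using \<psi> h(1) \<phi>_in[OF that] by (auto simp: bij_betw_def)
    then show ?thesis unfolding h'_def by (simp add: inv_into_into f_inv_into_f)
  qed
  have Gattr: "lab G' e = lab G (\<phi> e)" "target G' e = target G (\<phi> e)" "occur G' e = occur G (\<phi> e)"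
    if "e \<in> out G' n" for e
    using G that by (auto simp: edge_renaming_def out_def)
  have Hattr: "lab H' f = lab H (\<psi> f)" "target H' f = target H (\<psi> f)" "occur H' f = occur H (\<psi> f)"
    if "f \<in> out H' m" for f
    using H that by (auto simp: edge_renaming_def out_def)
  have "interval_set (\<Sum>e\<in>{e \<in> out G' n. h' e = f}. occur G' e) \<subseteq> interval_set (occur H' f)"
    if f: "f \<in> out H' m" for f
  proof -
    have \<psi>f: "\<psi> f \<in> out H m" using \<psi> f by (auto simp: bij_betw_def)
    have "\<phi> ` {e \<in> out G' n. h' e = f} = {e \<in> out G n. h e = \<psi> f}"
    proof (intro equalityI subsetI)
      fix e assume e: "e \<in> {e \<in> out G n. h e = \<psi> f}"
      then have "e \<in> \<phi> ` out G' n" using \<phi> by (simp add: bij_betw_def)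
      then obtain e' where e': "e' \<in> out G' n" "e = \<phi> e'" by blast
      then have "\<psi> (h' e') = \<psi> f" using h' e by auto
      then have "h' e' = f"
        using inj_onD[of \<psi> "out H' m" "h' e'" f] \<psi> h'[OF e'(1)] f by (simp add: bij_betw_def)
      with e' show "e \<in> \<phi> ` {e \<in> out G' n. h' e = f}" by blast
    qed (use h' \<phi>_in in auto)
    then have "bij_betw \<phi> {e \<in> out G' n. h' e = f} {e \<in> out G n. h e = \<psi> f}"
      using \<phi> by (auto simp: bij_betw_def intro: inj_on_subset)
    then have "(\<Sum>e\<in>{e \<in> out G n. h e = \<psi> f}. occur G e) =
        (\<Sum>e\<in>{e \<in> out G' n. h' e = f}. occur G (\<phi> e))"
      by (rule sum.reindex_bij_betw[symmetric])
    also have "\<dots> = (\<Sum>e\<in>{e \<in> out G' n. h' e = f}. occur G' e)"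
      using Gattr by (intro sum.cong) auto
    finally show ?thesis using h(3)[OF \<psi>f] Hattr[OF f] by simp
  qed
  moreover have "lab G' e = lab H' (h' e) \<and> (target G' e, target H' (h' e)) \<in> R"
    if "e \<in> out G' n" for e
    using h(2)[OF \<phi>_in[OF that]] h'[OF that] Gattr[OF that] Hattr[of "h' e"] by auto
  ultimately show "local_match G' H' R n m"
    unfolding local_match_def using h' by (intro exI[of _ h']) blast
qed

text \<open>The surrounding lists allow for both graphs of the input: \<open>u\<close> is empty for
  the first one, \<open>w\<close> for the second. The lengths in the code fix where it ends, so the
  graph is recovered up to the names of its edges.\<close>

lemma decode_encodes:
  assumes G: "shape_graph \<Sigma> G" and enc: "encodes \<kappa> v G" and inj: "inj_on \<kappa> \<Sigma>"
    and x: "x = u @ v @ w"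
  shows "graph_length x (length u) = length v" "valid_graph (\<kappa> ` \<Sigma>) x (length u)"
    "\<exists>\<phi>. edge_renaming \<phi> (decode \<Sigma> \<kappa> x (length u)) G"
proof -
  let ?p = "length u"
  obtain ns es where ns: "distinct ns" "set ns = nodes G" and es: "distinct es" "set es = edges G"
    and v: "v = length ns # ns @ length es # concat (map (encode_edge \<kappa> G) es)"
    using enc unfolding encodes_def by blast
  let ?c = "concat (map (encode_edge \<kappa> G) es)"
  have lc: "length ?c = 5 * length es" by (rule length_concat_map) (rule length_encode_edge)
  have at: "input_at x (?p + i) = v ! i" if "i < length v" for i
    using that x by (simp add: input_at_def nth_append)
  have n: "num_nodes x ?p = length ns"
    using at[of 0] by (simp add: num_nodes_def v)
  have m: "num_edges x ?p = length es"
    using at[of "1 + length ns"] by (simp add: num_edges_def n v nth_append)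
  show len: "graph_length x ?p = length v"
    by (simp add: graph_length_def n m v lc)
  have node: "node_at x ?p i = ns ! i" if "i < length ns" for i
    using at[of "1 + i"] that by (simp add: node_at_def v nth_append)
  have entry: "edge_entry x ?p e k = encode_edge \<kappa> G (es ! e) ! k" if "e < length es" "k < 5" for e k
  proof -
    have lt: "5 * e + k < length ?c" using that lc by simp
    have "edge_entry x ?p e k = v ! (2 + length ns + (5 * e + k))"
      using at[of "2 + length ns + (5 * e + k)"] lt by (simp add: edge_entry_def n v add.assoc)
    also have "\<dots> = ?c ! (5 * e + k)" by (simp add: v nth_append)
    also have "\<dots> = encode_edge \<kappa> G (es ! e) ! k"
      by (rule concat_map_nth[OF length_encode_edge that])
    finally show ?thesis .
  qed
  have edge: "edge_entry x ?p e 0 = source G (es ! e)" "edge_entry x ?p e 1 = target G (es ! e)"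
    "edge_entry x ?p e 2 = \<kappa> (lab G (es ! e))"
    "decode_interval (edge_entry x ?p e 3, edge_entry x ?p e 4) = occur G (es ! e)"
    if "e < length es" for e
  proof -
    obtain l k where I: "encode_interval (occur G (es ! e)) = [l, k]"
      by (cases "occur G (es ! e)") auto
    then have "encode_edge \<kappa> G (es ! e) =
      [source G (es ! e), target G (es ! e), \<kappa> (lab G (es ! e)), l, k]"
      by (simp add: encode_edge_def)
    then show "edge_entry x ?p e 0 = source G (es ! e)" "edge_entry x ?p e 1 = target G (es ! e)"
      "edge_entry x ?p e 2 = \<kappa> (lab G (es ! e))"
      "decode_interval (edge_entry x ?p e 3, edge_entry x ?p e 4) = occur G (es ! e)"
      using entry[OF that] decode_encode_interval[OF I] by (simp_all del: decode_interval.simps)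
  qed
  have nodes: "node_at x ?p ` {..<num_nodes x ?p} = nodes G"
  proof -
    have "node_at x ?p ` {..<num_nodes x ?p} = (\<lambda>i. ns ! i) ` {..<length ns}"
      using node n by (intro image_cong) auto
    also have "\<dots> = set ns" by (auto simp: set_conv_nth)
    finally show ?thesis using ns(2) by simp
  qed
  have in_edges: "es ! e \<in> edges G" if "e < length es" for e
    using nth_mem[OF that] es(2) by simp
  have attr: "source G f \<in> nodes G" "target G f \<in> nodes G" "lab G f \<in> \<Sigma>"
    "occur G f \<in> basic_intervals" if "f \<in> edges G" for f
    using that G unfolding shape_graph_def is_graph_def by blast+
  have "inj_on (node_at x ?p) {..<num_nodes x ?p}"
    using node n ns(1) by (auto simp: inj_on_def nth_eq_iff_index_eq)
  moreover have "edge_entry x ?p e 0 \<in> nodes G \<and> edge_entry x ?p e 1 \<in> nodes G \<and>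
      edge_entry x ?p e 2 \<in> \<kappa> ` \<Sigma> \<and> edge_entry x ?p e 3 < 2 \<and>
      (edge_entry x ?p e 4 = 0 \<or> edge_entry x ?p e 4 = 2)" if "e < length es" for e
    unfolding edge(1-3)[OF that] decode_interval_basic_iff[symmetric] edge(4)[OF that]
    using attr[OF in_edges[OF that]] by blast
  ultimately show "valid_graph (\<kappa> ` \<Sigma>) x ?p"
    unfolding valid_graph_def nodes m by blast
  have bij: "bij_betw (\<lambda>e. es ! e) {..<length es} (edges G)"
    by (rule bij_betw_nth) (use es in simp_all)
  let ?D = "decode \<Sigma> \<kappa> x ?p"
  have "source ?D e = source G (es ! e) \<and> target ?D e = target G (es ! e) \<and>
      lab ?D e = lab G (es ! e) \<and> occur ?D e = occur G (es ! e)" if "e < length es" for e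
    using edge[OF that] inj attr(3)[OF in_edges[OF that]]
    by (simp add: decode_def del: decode_interval.simps)
  moreover have "nodes ?D = nodes G" "edges ?D = {..<length es}"
    by (simp_all only: decode_def graph.simps nodes m)
  ultimately have "edge_renaming (\<lambda>e. es ! e) ?D G"
    using bij unfolding edge_renaming_def by simp
  then show "\<exists>\<phi>. edge_renaming \<phi> ?D G" by blast
qed

text \<open>Removes the quantifiers over splittings and graphs. An embedding of encoded graphs is
  transferred to the decoded ones by renaming edges; conversely the decoded graphs are themselves
  witnesses.\<close>

lemma shape_embedding_problem_iff:
  assumes inj: "inj_on \<kappa> \<Sigma>"
  shows "x \<in> shape_embedding_problem \<Sigma> \<kappa> \<longleftrightarrow>
    valid_input (\<kappa> ` \<Sigma>) x \<and> decode \<Sigma> \<kappa> x 0 \<preceq> decode \<Sigma> \<kappa> x (second x)"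
proof
  assume "x \<in> shape_embedding_problem \<Sigma> \<kappa>"
  then obtain v w and G H :: "(nat, nat, 'a) graph" where x: "x = v @ w"
    and G: "shape_graph \<Sigma> G" "encodes \<kappa> v G" and H: "shape_graph \<Sigma> H" "encodes \<kappa> w H"
    and emb: "G \<preceq> H"
    unfolding shape_embedding_problem_def by blast
  have "x = [] @ v @ w" "x = v @ w @ []" using x by simp_all
  note 1 = decode_encodes[OF G inj this(1)] and 2 = decode_encodes[OF H inj this(2)]
  have sec: "second x = length v" using 1(1) by simp
  have "valid_input (\<kappa> ` \<Sigma>) x"
    using 1 2 sec x by (simp add: valid_input_def)
  moreover obtain \<phi> \<psi> where ren: "edge_renaming \<phi> (decode \<Sigma> \<kappa> x 0) G"
    "edge_renaming \<psi> (decode \<Sigma> \<kappa> x (second x)) H"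
    using 1(3) 2(3) sec by auto
  obtain R where "simulation G H R" "Domain R = nodes G"
    using emb by (auto simp: embeds_def embedding_def)
  with ren have "embedding (decode \<Sigma> \<kappa> x 0) (decode \<Sigma> \<kappa> x (second x)) R"
    unfolding embedding_def
    using simulation_edge_renaming[OF ren] by (auto simp: edge_renaming_def)
  ultimately show "valid_input (\<kappa> ` \<Sigma>) x \<and> decode \<Sigma> \<kappa> x 0 \<preceq> decode \<Sigma> \<kappa> x (second x)"
    by (auto simp: embeds_def)
next
  let ?G = "decode \<Sigma> \<kappa> x 0" and ?H = "decode \<Sigma> \<kappa> x (second x)"
  let ?v = "take (second x) x" and ?w = "drop (second x) x"
  assume valid: "valid_input (\<kappa> ` \<Sigma>) x \<and> ?G \<preceq> ?H"
  then have "encodes \<kappa> ?v ?G"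
    using encodes_decode[of \<kappa> \<Sigma> x 0] by (simp add: valid_input_def)
  moreover have "encodes \<kappa> ?w ?H"
  proof -
    have "take (graph_length x (second x)) ?w = ?w"
      by (rule take_all) (use valid in \<open>auto simp: valid_input_def\<close>)
    then show ?thesis
      using encodes_decode[of \<kappa> \<Sigma> x "second x"] valid by (simp add: valid_input_def)
  qed
  moreover have "shape_graph \<Sigma> ?G" "shape_graph \<Sigma> ?H"
    using valid shape_graph_decode by (auto simp: valid_input_def)
  moreover have "x = ?v @ ?w" by simp
  ultimately show "x \<in> shape_embedding_problem \<Sigma> \<kappa>"
    using valid unfolding shape_embedding_problem_def by blast
qed

section \<open>Refinement of the largest simulation\<close>

text \<open>Entry \<open>N * i + j\<close> of the array \<open>Z\<close>, where \<open>N\<close> is the length of the input, becomes nonzero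
  when the pair of the \<open>i\<close>-th node of the first and the \<open>j\<close>-th node of the second graph is removed.\<close>

definition related :: "nat list \<Rightarrow> (nat \<Rightarrow> nat) \<Rightarrow> (nat \<times> nat) set" where
  "related x Z = {(node_at x 0 i, node_at x (second x) j) |i j.
     i < num_nodes x 0 \<and> j < num_nodes x (second x) \<and> Z (length x * i + j) = 0}"

definition edge_ok :: "nat list \<Rightarrow> nat \<Rightarrow> nat \<Rightarrow> (nat \<Rightarrow> nat) \<Rightarrow> nat \<Rightarrow> nat \<Rightarrow> bool" where
  "edge_ok x i j Z u v \<longleftrightarrow> u < num_edges x 0 \<and> v < num_edges x (second x) \<and>
     edge_entry x 0 u 0 = node_at x 0 i \<and>
     edge_entry x (second x) v 0 = node_at x (second x) j \<and>
     edge_entry x 0 u 2 = edge_entry x (second x) v 2 \<and>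
     (edge_entry x 0 u 1, edge_entry x (second x) v 1) \<in> related x Z"

text \<open>The relation \<open>adj\<close> of the local condition, in terms of codes: a last field
  0 means infinity, so it must be treated separately when upper bounds are compared.\<close>

definition fits :: "nat list \<Rightarrow> nat \<Rightarrow> nat \<Rightarrow> (nat \<Rightarrow> nat) \<Rightarrow> nat \<Rightarrow> nat \<Rightarrow> bool" where
  "fits x i j Z u v \<longleftrightarrow> edge_ok x i j Z u v \<and>
     edge_entry x (second x) v 3 \<le> edge_entry x 0 u 3 \<and>
     (edge_entry x (second x) v 4 = 0 \<or>
      edge_entry x 0 u 4 \<noteq> 0 \<and> edge_entry x 0 u 4 \<le> edge_entry x (second x) v 4)"

definition bounded_edge :: "nat list \<Rightarrow> nat \<Rightarrow> nat \<Rightarrow> (nat \<Rightarrow> nat) \<Rightarrow> nat \<Rightarrow> bool" where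
  "bounded_edge x i j Z u \<longleftrightarrow> u < num_edges x 0 \<and> edge_entry x 0 u 0 = node_at x 0 i \<and>
     \<not> (\<exists>v. edge_ok x i j Z u v \<and> edge_entry x (second x) v 4 = 0)"

definition mandatory_edge :: "nat list \<Rightarrow> nat \<Rightarrow> nat \<Rightarrow> bool" where
  "mandatory_edge x j v \<longleftrightarrow> v < num_edges x (second x) \<and>
     edge_entry x (second x) v 0 = node_at x (second x) j \<and> edge_entry x (second x) v 3 > 0"

lemma snd_decode_interval_le_iff:
  "snd (decode_interval (l, u)) \<le> snd (decode_interval (l', u')) \<longleftrightarrow> u' = 0 \<or> u \<noteq> 0 \<and> u \<le> u'"
  by auto

lemma local_match_iff_covers:
  assumes inj: "inj_on \<kappa> \<Sigma>" and valid: "valid_input (\<kappa> ` \<Sigma>) x"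
  shows "local_match (decode \<Sigma> \<kappa> x 0) (decode \<Sigma> \<kappa> x (second x)) (related x Z)
           (node_at x 0 i) (node_at x (second x) j) \<longleftrightarrow>
         has_cover (bounded_edge x i j Z) (fits x i j Z) \<and>
         has_cover (mandatory_edge x j) (\<lambda>v u. fits x i j Z u v)"
proof -
  let ?G = "decode \<Sigma> \<kappa> x 0" and ?H = "decode \<Sigma> \<kappa> x (second x)"
  let ?E = "out ?G (node_at x 0 i)" and ?F = "out ?H (node_at x (second x) j)"
  let ?ok = "\<lambda>e f. lab ?G e = lab ?H f \<and> (target ?G e, target ?H f) \<in> related x Z"
  have E: "e \<in> ?E \<longleftrightarrow> e < num_edges x 0 \<and> edge_entry x 0 e 0 = node_at x 0 i" for e
    by (simp add: out_def decode_def)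
  have F: "f \<in> ?F \<longleftrightarrow> f < num_edges x (second x) \<and>
      edge_entry x (second x) f 0 = node_at x (second x) j" for f
    by (simp add: out_def decode_def)
  have shape: "shape_graph \<Sigma> ?G" "shape_graph \<Sigma> ?H"
    using valid shape_graph_decode by (auto simp: valid_input_def)
  then have fin: "finite ?E" and basic: "\<And>e. e \<in> ?E \<Longrightarrow> occur ?G e \<in> basic_intervals"
    "\<And>f. f \<in> ?F \<Longrightarrow> occur ?H f \<in> basic_intervals"
    by (auto simp: shape_graph_def is_graph_def out_def)
  \<comment> \<open>Validity puts both numbers into the image of \<open>\<kappa>\<close>, where
    \<open>inv_into\<close> is injective, so comparing numbers amounts to comparing labels.\<close>
  have lab: "lab ?G e = lab ?H f \<longleftrightarrow> edge_entry x 0 e 2 = edge_entry x (second x) f 2"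
    if "e \<in> ?E" "f \<in> ?F" for e f
  proof -
    have "edge_entry x 0 e 2 \<in> \<kappa> ` \<Sigma>" "edge_entry x (second x) f 2 \<in> \<kappa> ` \<Sigma>"
      using that valid unfolding E F valid_input_def valid_graph_def by blast+
    then show ?thesis by (auto simp: decode_def dest: inv_into_injective)
  qed
  have ok: "edge_ok x i j Z e f \<longleftrightarrow> e \<in> ?E \<and> f \<in> ?F \<and> ?ok e f" for e f
    using lab[of e f] unfolding edge_ok_def E F by (auto simp: decode_def)
  have fits: "fits x i j Z = (\<lambda>e f. e \<in> ?E \<and> f \<in> ?F \<and> ?ok e f \<and>
      fst (occur ?H f) \<le> fst (occur ?G e) \<and> snd (occur ?G e) \<le> snd (occur ?H f))"
    by (intro ext, unfold fits_def ok)
      (simp add: decode_def snd_decode_interval_le_iff conj_assoc del: decode_interval.simps, simp)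
  have unbounded: "snd (occur ?H f) = \<infinity> \<longleftrightarrow> edge_entry x (second x) f 4 = 0" for f
    by (simp add: decode_def)
  have bounded: "bounded_edge x i j Z = (\<lambda>e. e \<in> ?E \<and> \<not> (\<exists>f\<in>?F. ?ok e f \<and> snd (occur ?H f) = \<infinity>))"
    unfolding bounded_edge_def ok unbounded conj_assoc[symmetric] E[symmetric]
    by (intro ext) blast
  have mandatory: "mandatory_edge x j = (\<lambda>f. f \<in> ?F \<and> fst (occur ?H f) > 0)"
    by (intro ext, unfold mandatory_edge_def F) (simp add: decode_def)
  show ?thesis
    unfolding local_match_def fits bounded mandatory
    by (rule local_condition_iff_covers[OF fin basic])
qed

text \<open>The second test sees \<open>Z'\<close>, as in the program, which runs both checks in
  turn on the same array. This makes no difference to the result: after a failed first test the pair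
  is already removed, and otherwise \<open>Z'\<close> is \<open>Z\<close>.\<close>

definition refine_step :: "nat list \<Rightarrow> nat \<Rightarrow> nat \<Rightarrow> (nat \<Rightarrow> nat) \<Rightarrow> nat \<Rightarrow> nat" where
  "refine_step x i j Z =
     (let Z' = if has_cover (bounded_edge x i j Z) (fits x i j Z) then Z
               else Z(length x * i + j := 1)
      in if has_cover (mandatory_edge x j) (\<lambda>v u. fits x i j Z' u v) then Z'
         else Z'(length x * i + j := 1))"

definition refined :: "nat list \<Rightarrow> nat \<Rightarrow> nat" where
  "refined x = (sweep (length x) (refine_step x) ^^ (length x * (length x * length x))) (\<lambda>_. 0)"

lemma pair_index_eq_iff:
  fixes N :: nat
  assumes "j < N" "j' < N"
  shows "N * i + j = N * i' + j' \<longleftrightarrow> i = i' \<and> j = j'"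
proof
  assume eq: "N * i + j = N * i' + j'"
  have "(N * i + j) div N = i" "(N * i' + j') div N = i'" using assms by simp_all
  with eq show "i = i' \<and> j = j'" by simp
qed simp

lemma pair_index_less:
  fixes N :: nat
  assumes "i < N" "j < N"
  shows "N * i + j < N * N"
proof -
  have "N * i + j < N * i + N" using assms by simp
  also have "\<dots> = N * Suc i" by simp
  also have "\<dots> \<le> N * N" using assms by (intro mult_le_mono2) simp
  finally show ?thesis .
qed

section \<open>Soundness and progress of the refinement\<close>

lemma local_match_mono:
  "local_match G H R n m \<Longrightarrow> R \<subseteq> R' \<Longrightarrow> local_match G H R' n m"
  unfolding local_match_def by blast

text \<open>A pair of \<open>S\<close> satisfies the local condition for \<open>S\<close>, hence by
  monotonicity for the larger relation. A pair at which a cover is missing therefore is not in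
  \<open>S\<close>.\<close>

lemma refine_upd_sound:
  assumes valid: "valid_input (\<kappa> ` \<Sigma>) x" and inj: "inj_on \<kappa> \<Sigma>"
    and sim: "simulation (decode \<Sigma> \<kappa> x 0) (decode \<Sigma> \<kappa> x (second x)) S"
    and sub: "S \<subseteq> related x Z"
    and no: "\<not> (has_cover (bounded_edge x i j Z) (fits x i j Z) \<and>
         has_cover (mandatory_edge x j) (\<lambda>v u. fits x i j Z u v))"
    and j: "j < length x"
  shows "S \<subseteq> related x (Z(length x * i + j := 1))"
proof
  fix nm assume nm: "nm \<in> S"
  then obtain i' j' where ij: "nm = (node_at x 0 i', node_at x (second x) j')"
    "i' < num_nodes x 0" "j' < num_nodes x (second x)" "Z (length x * i' + j') = 0"
    using sub by (auto simp: related_def)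
  have "graph_length x (second x) \<le> length x" using valid by (simp add: valid_input_def)
  then have "num_nodes x (second x) < length x" by (simp add: graph_length_def)
  then have j': "j' < length x" using ij by simp
  have "(i', j') \<noteq> (i, j)"
  proof
    assume "(i', j') = (i, j)"
    then have "local_match (decode \<Sigma> \<kappa> x 0) (decode \<Sigma> \<kappa> x (second x)) S
        (node_at x 0 i) (node_at x (second x) j)"
      using sim nm ij by (simp add: simulation_iff_local_match)
    from local_match_mono[OF this sub] show False
      using no local_match_iff_covers[OF inj valid] by blast
  qed
  then have "length x * i' + j' \<noteq> length x * i + j"
    using pair_index_eq_iff[OF j' j, of i' i] by simp
  then show "nm \<in> related x (Z(length x * i + j := 1))"
    using ij unfolding related_def by auto
qed

lemma refine_step_sound:
  assumes "valid_input (\<kappa> ` \<Sigma>) x" and "inj_on \<kappa> \<Sigma>"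
    and "simulation (decode \<Sigma> \<kappa> x 0) (decode \<Sigma> \<kappa> x (second x)) S"
    and "S \<subseteq> related x Z" and "j < length x"
  shows "S \<subseteq> related x (refine_step x i j Z)"
proof -
  define Z' where "Z' = (if has_cover (bounded_edge x i j Z) (fits x i j Z) then Z
    else Z(length x * i + j := 1))"
  have Z': "S \<subseteq> related x Z'"
    unfolding Z'_def using assms(4) refine_upd_sound[OF assms(1-4) _ assms(5), of i]
    by (simp del: One_nat_def)
  show ?thesis
    unfolding refine_step_def Z'_def[symmetric] Let_def
    using Z' refine_upd_sound[OF assms(1-3) Z' _ assms(5), of i] by (simp del: One_nat_def)
qed

definition num_removed :: "nat \<Rightarrow> (nat \<Rightarrow> nat) \<Rightarrow> nat" where
  "num_removed M Z = card {k. k < M \<and> Z k \<noteq> 0}"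

lemma num_removed_upd:
  assumes "k < M" "Z k = 0"
  shows "num_removed M Z < num_removed M (Z(k := 1))"
proof -
  have "{l. l < M \<and> (Z(k := 1)) l \<noteq> 0} = insert k {l. l < M \<and> Z l \<noteq> 0}"
    using assms(1) by auto
  then show ?thesis using assms(2) by (simp add: num_removed_def)
qed

text \<open>With entries in 0 and 1, overwriting a removed entry changes nothing, so every step that
  does change \<open>Z\<close> removes a new pair.\<close>

lemma refine_step_progress:
  assumes "i < length x" "j < length x" "\<forall>k. Z k \<le> 1"
  defines "M \<equiv> length x * length x" and "k \<equiv> length x * i + j"
  shows "refine_step x i j Z = Z \<and>
      (Z k = 0 \<longrightarrow> has_cover (bounded_edge x i j Z) (fits x i j Z) \<and>
         has_cover (mandatory_edge x j) (\<lambda>v u. fits x i j Z u v)) \<or>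
    num_removed M Z < num_removed M (refine_step x i j Z)"
proof (cases "Z k = 0")
  case True
  have "num_removed M Z < num_removed M (Z(k := 1))"
    using pair_index_less[OF assms(1,2)] True unfolding M_def k_def by (rule num_removed_upd)
  then show ?thesis
    unfolding refine_step_def k_def Let_def by auto
next
  case False
  then have "Z k = 1" using assms(3) by (metis le_neq_implies_less less_one)
  then have "Z(k := 1) = Z" by auto
  then show ?thesis using False by (simp add: refine_step_def k_def)
qed

lemma refine_step_le_1: "\<forall>k. Z k \<le> 1 \<Longrightarrow> \<forall>k. refine_step x i j Z k \<le> 1"
  by (simp add: refine_step_def Let_def)

text \<open>No simulation ever loses a pair, and at the fixed point the remaining pairs form a
  simulation. This is thus the largest one, and an embedding exists iff its domain contains all
  nodes.\<close>

lemma embeds_iff_refined: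
  assumes valid: "valid_input (\<kappa> ` \<Sigma>) x" and inj: "inj_on \<kappa> \<Sigma>"
  shows "decode \<Sigma> \<kappa> x 0 \<preceq> decode \<Sigma> \<kappa> x (second x) \<longleftrightarrow>
    (\<forall>i<num_nodes x 0. \<exists>j<num_nodes x (second x). refined x (length x * i + j) = 0)"
proof -
  let ?G = "decode \<Sigma> \<kappa> x 0" and ?H = "decode \<Sigma> \<kappa> x (second x)"
  let ?N = "length x"
  let ?a = "num_nodes x 0" and ?c = "num_nodes x (second x)"
  have len: "?a + ?c + 4 \<le> ?N"
    using valid by (simp add: valid_input_def graph_length_def)
  let ?I = "\<lambda>Z. (\<forall>k. Z k \<le> 1) \<and> (\<forall>S. simulation ?G ?H S \<longrightarrow> S \<subseteq> related x Z)"
  let ?Q = "\<lambda>Z i j. Z (?N * i + j) = 0 \<longrightarrow> has_cover (bounded_edge x i j Z) (fits x i j Z) \<and>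
    has_cover (mandatory_edge x j) (\<lambda>v u. fits x i j Z u v)"
  have nodes: "nodes ?G = node_at x 0 ` {..<?a}" "nodes ?H = node_at x (second x) ` {..<?c}"
    by (simp_all add: decode_def)
  have "?I (refined x) \<and> (\<forall>i<?N. \<forall>j<?N. ?Q (refined x) i j)"
    unfolding refined_def
  proof (rule iterate_until_stuck[where \<mu> = "num_removed (?N * ?N)" and M = "?N * ?N"])
    fix Z assume Z: "?I Z"
    show "?I (sweep ?N (refine_step x) Z) \<and>
      (sweep ?N (refine_step x) Z = Z \<and> (\<forall>i<?N. \<forall>j<?N. ?Q Z i j) \<or>
       num_removed (?N * ?N) Z < num_removed (?N * ?N) (sweep ?N (refine_step x) Z))"
    proof (rule sweep_progress[where I = ?I and Q = "\<lambda>i j Z. ?Q Z i j"])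
      fix i j Y assume "i < ?N" "j < ?N" and Y: "?I Y"
      then show "?I (refine_step x i j Y) \<and> (refine_step x i j Y = Y \<and> ?Q Y i j \<or>
          num_removed (?N * ?N) Y < num_removed (?N * ?N) (refine_step x i j Y))"
        using refine_step_progress[of i x j Y] refine_step_le_1[of Y x i j]
          refine_step_sound[OF valid inj, of _ Y j i] by blast
    qed (rule Z)
  next
    fix Z :: "nat \<Rightarrow> nat"
    have "card {k. k < ?N * ?N \<and> Z k \<noteq> 0} \<le> card {..<?N * ?N}" by (intro card_mono) auto
    then show "num_removed (?N * ?N) Z \<le> ?N * ?N" by (simp add: num_removed_def)
  next
    have "related x (\<lambda>_. 0) = nodes ?G \<times> nodes ?H"
      by (auto simp: related_def nodes)
    then show "?I (\<lambda>_. 0)"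
      by (simp add: simulation_iff_local_match)
    have "x \<noteq> []" using len by auto
    then show "?N * ?N < ?N * (?N * ?N)" using len by simp
  qed
  then have le: "\<And>S. simulation ?G ?H S \<Longrightarrow> S \<subseteq> related x (refined x)"
    and stuck: "\<And>i j. i < ?N \<Longrightarrow> j < ?N \<Longrightarrow> ?Q (refined x) i j" by blast+
  have sim: "simulation ?G ?H (related x (refined x))"
    unfolding simulation_iff_local_match
  proof (intro conjI allI impI)
    show "related x (refined x) \<subseteq> nodes ?G \<times> nodes ?H" by (auto simp: related_def nodes)
    fix n m assume "(n, m) \<in> related x (refined x)"
    then obtain i j where ij: "n = node_at x 0 i" "m = node_at x (second x) j" "i < ?a" "j < ?c"
      "refined x (?N * i + j) = 0"
      by (auto simp: related_def)
    moreover have "i < ?N" "j < ?N" using ij len by linarith+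
    ultimately show "local_match ?G ?H (related x (refined x)) n m"
      using stuck[of i j] local_match_iff_covers[OF inj valid] by blast
  qed
  have "?G \<preceq> ?H \<longleftrightarrow> Domain (related x (refined x)) = nodes ?G"
  proof
    assume "?G \<preceq> ?H"
    then obtain S where S: "simulation ?G ?H S" "Domain S = nodes ?G"
      by (auto simp: embeds_def embedding_def)
    have "Domain S \<subseteq> Domain (related x (refined x))" using le[OF S(1)] by blast
    moreover have "Domain (related x (refined x)) \<subseteq> nodes ?G"
      by (auto simp: related_def nodes)
    ultimately show "Domain (related x (refined x)) = nodes ?G" using S(2) by simp
  qed (use sim in \<open>auto simp: embeds_def embedding_def\<close>)
  also have "\<dots> \<longleftrightarrow> (\<forall>i<?a. \<exists>j<?c. refined x (?N * i + j) = 0)"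
  proof
    assume dom: "Domain (related x (refined x)) = nodes ?G"
    show "\<forall>i<?a. \<exists>j<?c. refined x (?N * i + j) = 0"
    proof (intro allI impI)
      fix i assume i: "i < ?a"
      then have "node_at x 0 i \<in> Domain (related x (refined x))" by (simp add: dom nodes)
      then obtain i' j where "node_at x 0 i = node_at x 0 i'" "i' < ?a" "j < ?c"
        "refined x (?N * i' + j) = 0" by (auto simp: related_def)
      \<comment> \<open>\<open>related\<close> speaks of nodes but the array of positions; since the
        listed nodes are distinct, the pair found belongs to position \<open>i\<close>
        itself.\<close>
      moreover have "inj_on (node_at x 0) {..<?a}"
        using valid by (simp add: valid_input_def valid_graph_def)
      ultimately show "\<exists>j<?c. refined x (?N * i + j) = 0"
        using i by (auto dest: inj_onD)
    qed
  next
    assume all: "\<forall>i<?a. \<exists>j<?c. refined x (?N * i + j) = 0"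
    show "Domain (related x (refined x)) = nodes ?G"
    proof
      show "nodes ?G \<subseteq> Domain (related x (refined x))"
        using all by (fastforce simp: related_def nodes Domain_iff)
    qed (auto simp: related_def nodes)
  qed
  finally show ?thesis .
qed

section \<open>The program\<close>

definition NotE :: "expr \<Rightarrow> expr" where "NotE e = Minus (Num 1) e"
definition AndE :: "expr \<Rightarrow> expr \<Rightarrow> expr" where "AndE e1 e2 = Ite e1 e2 (Num 0)"
definition OrE :: "expr \<Rightarrow> expr \<Rightarrow> expr" where "OrE e1 e2 = Plus e1 e2"
definition ImpE :: "expr \<Rightarrow> expr \<Rightarrow> expr" where "ImpE e1 e2 = Ite e1 e2 (Num 1)"
definition LtE :: "expr \<Rightarrow> expr \<Rightarrow> expr" where "LtE e1 e2 = Minus e2 e1"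
definition LeE :: "expr \<Rightarrow> expr \<Rightarrow> expr" where "LeE e1 e2 = Minus (Plus e2 (Num 1)) e1"
definition EqE :: "expr \<Rightarrow> expr \<Rightarrow> expr" where
  "EqE e1 e2 = NotE (Plus (Minus e1 e2) (Minus e2 e1))"
definition ExE :: "nat \<Rightarrow> expr \<Rightarrow> expr" where "ExE v e = Bsum v e"
definition AllE :: "nat \<Rightarrow> expr \<Rightarrow> expr" where "AllE v e = NotE (Bsum v (NotE e))"

text \<open>Any positive number counts as true. Thus a sum is a disjunction and a truncated
  difference a comparison.\<close>

abbreviation holds :: "nat list \<Rightarrow> heap \<Rightarrow> env \<Rightarrow> expr \<Rightarrow> bool" where
  "holds x h s e \<equiv> 0 < eval x h s e"

lemma sum_lessThan_pos_iff: "0 < (\<Sum>k<n::nat. f k :: nat) \<longleftrightarrow> (\<exists>k<n. 0 < f k)"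
  by (induction n) (auto simp: less_Suc_eq)

lemma holds_simps [simp]:
  "holds x h s (NotE e) \<longleftrightarrow> \<not> holds x h s e"
  "holds x h s (AndE e1 e2) \<longleftrightarrow> holds x h s e1 \<and> holds x h s e2"
  "holds x h s (OrE e1 e2) \<longleftrightarrow> holds x h s e1 \<or> holds x h s e2"
  "holds x h s (ImpE e1 e2) \<longleftrightarrow> (holds x h s e1 \<longrightarrow> holds x h s e2)"
  "holds x h s (LtE e1 e2) \<longleftrightarrow> eval x h s e1 < eval x h s e2"
  "holds x h s (LeE e1 e2) \<longleftrightarrow> eval x h s e1 \<le> eval x h s e2"
  "holds x h s (EqE e1 e2) \<longleftrightarrow> eval x h s e1 = eval x h s e2"
  "holds x h s (ExE v e) \<longleftrightarrow> (\<exists>k<length x. holds x h (s(v := k)) e)"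
  "holds x h s (AllE v e) \<longleftrightarrow> (\<forall>k<length x. holds x h (s(v := k)) e)"
  by (auto simp: NotE_def AndE_def OrE_def ImpE_def LtE_def LeE_def EqE_def ExE_def AllE_def
      sum_lessThan_pos_iff Suc_le_eq)

text \<open>The output has to be exactly 0 or 1, which \<open>holds\<close> does not control.
  \<open>AndE\<close> passes on the value of its last conjunct, so it is enough to end the result
  with \<open>AllE\<close>.\<close>

lemma eval_AllE:
  "eval x h s (AllE v e) = (if \<forall>k<length x. holds x h (s(v := k)) e then 1 else 0)"
proof -
  have "1 - c = (if 0 < 1 - c then 1 else 0)" for c :: nat by auto
  then show ?thesis unfolding holds_simps(9)[symmetric] AllE_def NotE_def eval.simps .
qed

lemma eval_AndE: "eval x h s (AndE e1 e2) = (if holds x h s e1 then eval x h s e2 else 0)"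
  by (simp add: AndE_def)

definition FiveE :: "expr \<Rightarrow> expr" where
  "FiveE e = Plus e (Plus e (Plus e (Plus e e)))"
definition NodesE :: "expr \<Rightarrow> expr" where
  "NodesE p = Inp p"
definition NodeE :: "expr \<Rightarrow> expr \<Rightarrow> expr" where
  "NodeE p i = Inp (Plus (Plus p (Num 1)) i)"
definition EdgesE :: "expr \<Rightarrow> expr" where
  "EdgesE p = Inp (Plus (Plus p (Num 1)) (NodesE p))"
definition EntryE :: "expr \<Rightarrow> expr \<Rightarrow> nat \<Rightarrow> expr" where
  "EntryE p e k = Inp (Plus (Plus (Plus (Plus p (Num 2)) (NodesE p)) (FiveE e)) (Num k))"
definition LengthE :: "expr \<Rightarrow> expr" where
  "LengthE p = Plus (Plus (Num 2) (NodesE p)) (FiveE (EdgesE p))"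
text \<open>The language lacks multiplication: summing \<open>Var i\<close> over the dummy variable
  9 gives the product with the length of the input, provided that \<open>i\<close> is not 9.\<close>

definition IndexE :: "nat \<Rightarrow> nat \<Rightarrow> expr" where
  "IndexE i j = Plus (Bsum 9 (Var i)) (Var j)"

abbreviation FirstE :: expr where "FirstE \<equiv> Num 0"
abbreviation SecondE :: expr where "SecondE \<equiv> LengthE (Num 0)"

lemma eval_FiveE [simp]: "eval x h s (FiveE e) = 5 * eval x h s e"
  by (simp add: FiveE_def)

lemma eval_simps [simp]:
  "eval x h s (NodesE p) = num_nodes x (eval x h s p)"
  "eval x h s (NodeE p e) = node_at x (eval x h s p) (eval x h s e)"
  "eval x h s (EdgesE p) = num_edges x (eval x h s p)"
  "eval x h s (EntryE p e k) = edge_entry x (eval x h s p) (eval x h s e) k"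
  "eval x h s (LengthE p) = graph_length x (eval x h s p)"
  "i \<noteq> 9 \<Longrightarrow> eval x h s (IndexE i j) = length x * s i + s j"
  by (simp_all add: NodesE_def NodeE_def EdgesE_def EntryE_def LengthE_def IndexE_def
      num_nodes_def node_at_def num_edges_def edge_entry_def graph_length_def)

definition BidC :: "(nat \<Rightarrow> expr) \<Rightarrow> (nat \<Rightarrow> nat \<Rightarrow> expr) \<Rightarrow> cmd" where
  "BidC bidE adjE = For 10 (For 11 (IfC
     (AndE (bidE 10) (AndE (adjE 10 11) (AndE (LeE (Arr 1 (Var 11)) Len)
       (AndE (AllE 12 (NotE (EqE (Arr 2 (Var 12)) (Plus (Var 10) (Num 1)))))
         (AllE 12 (ImpE (adjE 10 12) (LeE (Arr 1 (Var 11)) (Arr 1 (Var 12)))))))))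
     (Seq (Put 1 (Var 11) (Plus (Arr 1 (Var 11)) (Num 1)))
          (Put 2 (Var 11) (Plus (Var 10) (Num 1))))))"

text \<open>The loops over 13, 14 and 15 merely count the \<open>length x\<close> cubed
  sweeps.\<close>

definition AuctionC :: "(nat \<Rightarrow> expr) \<Rightarrow> (nat \<Rightarrow> nat \<Rightarrow> expr) \<Rightarrow> cmd" where
  "AuctionC bidE adjE =
     Seq (For 10 (Seq (Put 1 (Var 10) (Num 0)) (Put 2 (Var 10) (Num 0))))
         (For 13 (For 14 (For 15 (BidC bidE adjE))))"

definition CheckC :: "(nat \<Rightarrow> expr) \<Rightarrow> (nat \<Rightarrow> nat \<Rightarrow> expr) \<Rightarrow> cmd" where
  "CheckC bidE adjE = Seq (AuctionC bidE adjE)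
     (IfC (NotE (AllE 10 (ImpE (bidE 10) (ExE 11 (EqE (Arr 2 (Var 11)) (Plus (Var 10) (Num 1)))))))
       (Put 0 (IndexE 0 1) (Num 1)))"

text \<open>
  Variables 0 and 1 hold the node indices \<open>i\<close> and \<open>j\<close>. Bidders and items are taken from the
  variables 10 to 15, which the formulas below do not bind, so that there is no capture.
\<close>

definition represents ::
  "nat list \<Rightarrow> nat \<Rightarrow> nat \<Rightarrow> (nat \<Rightarrow> expr) \<Rightarrow> ((nat \<Rightarrow> nat) \<Rightarrow> nat \<Rightarrow> bool) \<Rightarrow> bool" where
  "represents x i j bidE bid \<longleftrightarrow> (\<forall>h s v. s 0 = i \<longrightarrow> s 1 = j \<longrightarrow> v \<in> {10..<16} \<longrightarrow>
     holds x h s (bidE v) = bid (h 0) (s v))"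

definition represents2 ::
  "nat list \<Rightarrow> nat \<Rightarrow> nat \<Rightarrow> (nat \<Rightarrow> nat \<Rightarrow> expr) \<Rightarrow> ((nat \<Rightarrow> nat) \<Rightarrow> nat \<Rightarrow> nat \<Rightarrow> bool) \<Rightarrow> bool" where
  "represents2 x i j adjE adj \<longleftrightarrow> (\<forall>h s u v. s 0 = i \<longrightarrow> s 1 = j \<longrightarrow>
     u \<in> {10..<16} \<longrightarrow> v \<in> {10..<16} \<longrightarrow> holds x h s (adjE u v) = adj (h 0) (s u) (s v))"

lemma fold_const: "fold (\<lambda>_. g) [0..<n] = g ^^ n"
  by (induction n) auto

text \<open>Applied with the projection to array 0. A check resets prices and owners before using
  them, so its effect on array 0 depends on array 0 alone.\<close>

lemma fold_hom:
  assumes "\<And>k y. \<pi> (f k y) = g k (\<pi> y)"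
  shows "\<pi> (fold f ks y) = fold g ks (\<pi> y)"
  by (induction ks arbitrary: y) (simp_all add: assms)

lemma run_BidC:
  assumes "represents x (s 0) (s 1) bidE bid" "represents2 x (s 0) (s 1) adjE adj"
  shows "run x s (BidC bidE adjE) = sweep (length x) (place_bid (length x) bid adj)"
proof -
  have "run x (s(10 := u, 11 := v)) (IfC
     (AndE (bidE 10) (AndE (adjE 10 11) (AndE (LeE (Arr 1 (Var 11)) Len)
       (AndE (AllE 12 (NotE (EqE (Arr 2 (Var 12)) (Plus (Var 10) (Num 1)))))
         (AllE 12 (ImpE (adjE 10 12) (LeE (Arr 1 (Var 11)) (Arr 1 (Var 12)))))))))
     (Seq (Put 1 (Var 11) (Plus (Arr 1 (Var 11)) (Num 1)))
          (Put 2 (Var 11) (Plus (Var 10) (Num 1))))) = place_bid (length x) bid adj u v" for u v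
    using assms unfolding represents_def represents2_def
    by - (rule ext, auto simp: place_bid_def may_bid_def)
  then show ?thesis
    unfolding BidC_def sweep_def run.simps(4) by (simp only:)
qed

lemma run_AuctionC:
  assumes "represents x (s 0) (s 1) bidE bid" "represents2 x (s 0) (s 1) adjE adj"
  shows "run x s (AuctionC bidE adjE) = auction (length x) bid adj"
proof -
  have "run x (s(13 := k, 14 := l, 15 := m)) (BidC bidE adjE) =
      sweep (length x) (place_bid (length x) bid adj)" for k l m
    by (rule run_BidC) (use assms in simp_all)
  then show ?thesis
    by - (rule ext, simp add: AuctionC_def auction_def empty_auction_def fold_const funpow_mult mult.assoc)
qed

lemma run_CheckC:
  assumes rep: "represents x (s 0) (s 1) bidE bid" "represents2 x (s 0) (s 1) adjE adj"
    and "3 \<le> length x" "\<And>Z u. bid Z u \<Longrightarrow> u < length x" "\<And>Z u v. adj Z u v \<Longrightarrow> v < length x"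
  shows "run x s (CheckC bidE adjE) h 0 =
    (if has_cover (bid (h 0)) (adj (h 0)) then h 0 else (h 0)(length x * s 0 + s 1 := 1))"
proof -
  let ?h = "auction (length x) bid adj h"
  let ?done = "AllE 10 (ImpE (bidE 10) (ExE 11 (EqE (Arr 2 (Var 11)) (Plus (Var 10) (Num 1)))))"
  have all: "(\<forall>u<length x. bid (h 0) u \<longrightarrow> (\<exists>v<length x. ?h 2 v = Suc u)) \<longleftrightarrow>
      has_cover (bid (h 0)) (adj (h 0))"
    and h0: "?h 0 = h 0"
    using auction_correct[of "length x" bid h adj] assms(3-5) by blast+
  have "holds x ?h (s(10 := u)) (bidE 10) \<longleftrightarrow> bid (h 0) u" for u
    using rep(1) h0 unfolding represents_def by simp
  then have "holds x ?h s ?done \<longleftrightarrow> has_cover (bid (h 0)) (adj (h 0))"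
    using all by simp
  moreover have "run x s (CheckC bidE adjE) h =
      (if holds x ?h s ?done then ?h else put 0 (length x * s 0 + s 1) 1 ?h)"
    unfolding CheckC_def run.simps run_AuctionC[OF rep] holds_simps(1) by auto
  ultimately show ?thesis
    using h0 by (simp add: put_def)
qed

text \<open>An edge gives its target by name, but array 0 is indexed by positions; the variables 2
  and 3 search for the positions of the two targets.\<close>

definition EdgeOkE :: "nat \<Rightarrow> nat \<Rightarrow> expr" where
  "EdgeOkE u v = AndE (LtE (Var u) (EdgesE FirstE)) (AndE (LtE (Var v) (EdgesE SecondE))
     (AndE (EqE (EntryE FirstE (Var u) 0) (NodeE FirstE (Var 0)))
     (AndE (EqE (EntryE SecondE (Var v) 0) (NodeE SecondE (Var 1)))
     (AndE (EqE (EntryE FirstE (Var u) 2) (EntryE SecondE (Var v) 2))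
     (ExE 2 (ExE 3 (AndE (LtE (Var 2) (NodesE FirstE)) (AndE (LtE (Var 3) (NodesE SecondE))
       (AndE (EqE (EntryE FirstE (Var u) 1) (NodeE FirstE (Var 2)))
       (AndE (EqE (EntryE SecondE (Var v) 1) (NodeE SecondE (Var 3)))
         (EqE (Arr 0 (IndexE 2 3)) (Num 0))))))))))))"

definition FitsE :: "nat \<Rightarrow> nat \<Rightarrow> expr" where
  "FitsE u v = AndE (EdgeOkE u v) (AndE (LeE (EntryE SecondE (Var v) 3) (EntryE FirstE (Var u) 3))
     (OrE (EqE (EntryE SecondE (Var v) 4) (Num 0))
       (AndE (NotE (EqE (EntryE FirstE (Var u) 4) (Num 0)))
         (LeE (EntryE FirstE (Var u) 4) (EntryE SecondE (Var v) 4)))))"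

text \<open>Variable 16 lies outside the range 10 to 15 of bidders and items, and away from the
  variables bound in \<open>EdgeOkE\<close>.\<close>

definition BoundedE :: "nat \<Rightarrow> expr" where
  "BoundedE u = AndE (LtE (Var u) (EdgesE FirstE))
     (AndE (EqE (EntryE FirstE (Var u) 0) (NodeE FirstE (Var 0)))
       (NotE (ExE 16 (AndE (EdgeOkE u 16) (EqE (EntryE SecondE (Var 16) 4) (Num 0))))))"

definition MandatoryE :: "nat \<Rightarrow> expr" where
  "MandatoryE v = AndE (LtE (Var v) (EdgesE SecondE))
     (AndE (EqE (EntryE SecondE (Var v) 0) (NodeE SecondE (Var 1)))
       (LtE (Num 0) (EntryE SecondE (Var v) 3)))"

text \<open>The variables 20, 21 and 22 only count sweeps. The positions 0 and 1 range over all
  numbers below the length of the input, of which \<open>related\<close> reads those of actual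
  nodes.\<close>

definition RefineC :: cmd where
  "RefineC = For 20 (For 21 (For 22 (For 0 (For 1
     (Seq (CheckC BoundedE FitsE) (CheckC MandatoryE (\<lambda>v u. FitsE u v)))))))"

definition MemberE :: "expr \<Rightarrow> nat \<Rightarrow> expr" where
  "MemberE p k = ExE 5 (AndE (LtE (Var 5) (NodesE p)) (EqE (EntryE p (Var 4) k) (NodeE p (Var 5))))"

text \<open>The finitely many label numbers are constants of the program; this is where finiteness
  of the label set enters.\<close>

definition LabelE :: "nat list \<Rightarrow> expr \<Rightarrow> expr" where
  "LabelE ks p = foldr (\<lambda>k e. OrE (EqE (EntryE p (Var 4) 2) (Num k)) e) ks (Num 0)"

definition ValidGraphE :: "nat list \<Rightarrow> expr \<Rightarrow> expr" where
  "ValidGraphE ks p = AndE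
     (AllE 4 (AllE 5 (ImpE (AndE (LtE (Var 4) (NodesE p)) (AndE (LtE (Var 5) (NodesE p))
        (EqE (NodeE p (Var 4)) (NodeE p (Var 5))))) (EqE (Var 4) (Var 5)))))
     (AllE 4 (ImpE (LtE (Var 4) (EdgesE p))
        (AndE (MemberE p 0) (AndE (MemberE p 1) (AndE (LabelE ks p)
          (AndE (LtE (EntryE p (Var 4) 3) (Num 2))
            (OrE (EqE (EntryE p (Var 4) 4) (Num 0)) (EqE (EntryE p (Var 4) 4) (Num 2)))))))))"

text \<open>Validity is tested only after the refinement, which runs on every input; for an invalid
  input the contents of array 0 are disregarded.\<close>

definition ResultE :: "nat list \<Rightarrow> expr" where
  "ResultE ks = AndE (EqE (Plus SecondE (LengthE SecondE)) Len)
     (AndE (ValidGraphE ks FirstE) (AndE (ValidGraphE ks SecondE)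
       (AllE 0 (ImpE (LtE (Var 0) (NodesE FirstE))
         (ExE 1 (AndE (LtE (Var 1) (NodesE SecondE)) (EqE (Arr 0 (IndexE 0 1)) (Num 0))))))))"

lemma holds_EdgeOkE:
  assumes "num_nodes x 0 \<le> length x" "num_nodes x (second x) \<le> length x" "10 \<le> u" "10 \<le> v"
  shows "holds x h s (EdgeOkE u v) \<longleftrightarrow> edge_ok x (s 0) (s 1) (h 0) (s u) (s v)"
proof -
  have "u \<noteq> 2" "u \<noteq> 3" "v \<noteq> 2" "v \<noteq> 3" using assms by simp_all
  moreover have "(\<exists>i<length x. \<exists>j<length x. i < num_nodes x 0 \<and> j < num_nodes x (second x) \<and> P i j) \<longleftrightarrow>
     (\<exists>i j. i < num_nodes x 0 \<and> j < num_nodes x (second x) \<and> P i j)" for P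
    using assms(1,2) order_less_le_trans by blast
  ultimately show ?thesis
    by (simp add: EdgeOkE_def edge_ok_def related_def) blast
qed

lemma represents_FitsE:
  assumes "num_nodes x 0 \<le> length x" "num_nodes x (second x) \<le> length x"
  shows "represents2 x i j FitsE (fits x i j)"
    "represents2 x i j (\<lambda>v u. FitsE u v) (\<lambda>Z v u. fits x i j Z u v)"
  using assms by (auto simp: represents2_def FitsE_def fits_def holds_EdgeOkE)

lemma represents_BoundedE:
  assumes "num_nodes x 0 \<le> length x" "num_nodes x (second x) \<le> length x"
    "num_edges x (second x) \<le> length x"
  shows "represents x i j BoundedE (bounded_edge x i j)"
  unfolding represents_def
proof (intro allI impI)
  fix h :: heap and s :: env and v :: nat assume "s 0 = i" "s 1 = j" "v \<in> {10..<16}"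
  moreover have "edge_ok x i j Z u w \<Longrightarrow> w < length x" for Z u w
    using assms(3) by (simp add: edge_ok_def)
  ultimately show "holds x h s (BoundedE v) = bounded_edge x i j (h 0) (s v)"
    using assms by (auto simp: BoundedE_def bounded_edge_def holds_EdgeOkE)
qed

lemma represents_MandatoryE: "represents x i j MandatoryE (\<lambda>_. mandatory_edge x j)"
  by (simp add: represents_def MandatoryE_def mandatory_edge_def)

text \<open>The equation bounds all numbers of nodes and edges by \<open>length x\<close> and makes
  \<open>length x\<close> at least 3, as the bounded loops and the number of sweeps of the auction
  require.\<close>

lemma run_RefineC:
  assumes len: "second x + graph_length x (second x) = length x"
  shows "run x s RefineC (\<lambda>_ _. 0) 0 = refined x"
proof -
  let ?N = "length x"
  have N: "num_nodes x 0 \<le> ?N" "num_nodes x (second x) \<le> ?N" "num_edges x 0 \<le> ?N"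
    "num_edges x (second x) \<le> ?N" "3 \<le> ?N"
    using len by (simp_all add: graph_length_def)
  define body where "body = Seq (CheckC BoundedE FitsE) (CheckC MandatoryE (\<lambda>v u. FitsE u v))"
  have fits: "fits x i j Z u v \<Longrightarrow> u < ?N \<and> v < ?N" for i j Z u v
    using N by (simp add: fits_def edge_ok_def)
  have bounded: "bounded_edge x i j Z u \<Longrightarrow> u < ?N" for i j Z u
    using N by (simp add: bounded_edge_def)
  have mandatory: "mandatory_edge x j u \<Longrightarrow> u < ?N" for j u
    using N by (simp add: mandatory_edge_def)
  have body: "run x s body h 0 = refine_step x (s 0) (s 1) (h 0)" for s h
  proof -
    let ?h = "run x s (CheckC BoundedE FitsE) h"
    have "?h 0 = (if has_cover (bounded_edge x (s 0) (s 1) (h 0)) (fits x (s 0) (s 1) (h 0))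
        then h 0 else (h 0)(?N * s 0 + s 1 := 1))"
      by (rule run_CheckC[OF represents_BoundedE represents_FitsE(1)])
        (use N fits bounded in blast)+
    moreover have "run x s (CheckC MandatoryE (\<lambda>v u. FitsE u v)) ?h 0 =
        (if has_cover (mandatory_edge x (s 1)) (\<lambda>v u. fits x (s 0) (s 1) (?h 0) u v)
         then ?h 0 else (?h 0)(?N * s 0 + s 1 := 1))"
      by (rule run_CheckC[OF represents_MandatoryE represents_FitsE(2)])
        (use N fits mandatory in blast)+
    ultimately show ?thesis
      by (simp only: body_def run.simps refine_step_def Let_def)
  qed
  have "run x s' (For 0 (For 1 body)) h 0 = sweep ?N (refine_step x) (h 0)" for s' h
    unfolding run.simps sweep_def
    by (rule fold_hom[where \<pi> = "\<lambda>h. h 0"], rule fold_hom[where \<pi> = "\<lambda>h. h 0"]) (simp add: body)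
  then have "run x s RefineC h 0 = (((sweep ?N (refine_step x) ^^ ?N) ^^ ?N) ^^ ?N) (h 0)" for h
    unfolding RefineC_def body_def[symmetric] run.simps(4)[of x _ 20] run.simps(4)[of x _ 21]
      run.simps(4)[of x _ 22] fold_const[symmetric]
    by (intro fold_hom[where \<pi> = "\<lambda>h. h 0"]) simp
  then show ?thesis
    by (simp add: refined_def funpow_mult mult.assoc)
qed

lemma holds_LabelE:
  "holds x h s (LabelE ks p) \<longleftrightarrow> edge_entry x (eval x h s p) (s 4) 2 \<in> set ks"
  unfolding LabelE_def by (induction ks) auto

lemma holds_ValidGraphE:
  assumes p: "\<And>s. eval x h s p = q" and "num_nodes x q \<le> length x" "num_edges x q \<le> length x"
  shows "holds x h s (ValidGraphE ks p) \<longleftrightarrow> valid_graph (set ks) x q"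
proof -
  have bound: "(\<exists>i<length x. i < num_nodes x q \<and> P i) \<longleftrightarrow> (\<exists>i<num_nodes x q. P i)"
    "(\<forall>i<length x. i < num_edges x q \<longrightarrow> P i) \<longleftrightarrow> (\<forall>i<num_edges x q. P i)" for P
    using assms(2,3) order_less_le_trans by blast+
  have inj: "(\<forall>i<length x. \<forall>j<length x. i < num_nodes x q \<and> j < num_nodes x q \<and>
      node_at x q i = node_at x q j \<longrightarrow> i = j) \<longleftrightarrow> inj_on (node_at x q) {..<num_nodes x q}"
    unfolding inj_on_def using assms(2) by force
  show ?thesis
    by (simp add: ValidGraphE_def valid_graph_def MemberE_def p holds_LabelE bound inj
        image_iff Bex_def conj_assoc)
qed

lemma eval_ResultE:
  "eval x h s (ResultE ks) = (if valid_input (set ks) x \<and>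
     (\<forall>i<num_nodes x 0. \<exists>j<num_nodes x (second x). h 0 (length x * i + j) = 0) then 1 else 0)"
proof -
  let ?ok = "second x + graph_length x (second x) = length x"
  let ?ex = "\<forall>i<length x. i < num_nodes x 0 \<longrightarrow>
      (\<exists>j<length x. j < num_nodes x (second x) \<and> h 0 (length x * i + j) = 0)"
  have "eval x h s (ResultE ks) = (if ?ok \<and> holds x h s (ValidGraphE ks FirstE) \<and>
      holds x h s (ValidGraphE ks SecondE) \<and> ?ex then 1 else 0)"
    unfolding ResultE_def by (subst eval_AndE)+ (subst eval_AllE, auto)
  \<comment> \<open>Only \<open>?ok\<close> guarantees that quantifiers below
    \<open>length x\<close> reach all nodes and edges. If it fails, both sides are 0.\<close>
  moreover have "valid_input (set ks) x \<longleftrightarrow> ?ok \<and> holds x h s (ValidGraphE ks FirstE) \<and>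
      holds x h s (ValidGraphE ks SecondE)"
    and "?ex \<longleftrightarrow> (\<forall>i<num_nodes x 0. \<exists>j<num_nodes x (second x). h 0 (length x * i + j) = 0)" if ?ok
  proof -
    have N: "num_nodes x 0 \<le> length x" "num_nodes x (second x) \<le> length x"
    "num_edges x 0 \<le> length x" "num_edges x (second x) \<le> length x"
      using that by (simp_all add: graph_length_def)
    show "?ex \<longleftrightarrow> (\<forall>i<num_nodes x 0. \<exists>j<num_nodes x (second x). h 0 (length x * i + j) = 0)"
      using N(1,2) order_less_le_trans by blast
    show "valid_input (set ks) x \<longleftrightarrow> ?ok \<and> holds x h s (ValidGraphE ks FirstE) \<and>
        holds x h s (ValidGraphE ks SecondE)"
      using N by (simp add: holds_ValidGraphE valid_input_def)
  qed
  moreover have "valid_input (set ks) x \<Longrightarrow> ?ok" by (simp add: valid_input_def)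
  ultimately show ?thesis by metis
qed

section \<open>Well-formedness of the program and conclusion\<close>

lemma expr_wf_simps [simp]:
  "expr_wf (NotE e) = expr_wf e"
  "expr_wf (AndE e1 e2) = (expr_wf e1 \<and> expr_wf e2)"
  "expr_wf (OrE e1 e2) = (expr_wf e1 \<and> expr_wf e2)"
  "expr_wf (ImpE e1 e2) = (expr_wf e1 \<and> expr_wf e2)"
  "expr_wf (LtE e1 e2) = (expr_wf e1 \<and> expr_wf e2)"
  "expr_wf (LeE e1 e2) = (expr_wf e1 \<and> expr_wf e2)"
  "expr_wf (EqE e1 e2) = (expr_wf e1 \<and> expr_wf e2)"
  "expr_wf (ExE v e) = expr_wf e"
  "expr_wf (AllE v e) = expr_wf e"
  "expr_wf (FiveE e) = expr_wf e"
  "expr_wf (NodesE p) = expr_wf p"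
  "expr_wf (NodeE p e) = (expr_wf p \<and> expr_wf e)"
  "expr_wf (EdgesE p) = expr_wf p"
  "expr_wf (EntryE p e k) = (expr_wf p \<and> expr_wf e)"
  "expr_wf (LengthE p) = expr_wf p"
  "expr_wf (IndexE i j)"
  by (auto simp: NotE_def AndE_def OrE_def ImpE_def LtE_def LeE_def EqE_def ExE_def AllE_def
      FiveE_def NodesE_def NodeE_def EdgesE_def EntryE_def LengthE_def IndexE_def)

lemma expr_wf_LabelE: "expr_wf p \<Longrightarrow> expr_wf (LabelE ks p)"
  unfolding LabelE_def by (induction ks) auto

theorem theorem1:
  fixes \<Sigma> :: "'l set" and \<kappa> :: "'l \<Rightarrow> nat"
  assumes "finite \<Sigma>" and "inj_on \<kappa> \<Sigma>"
  shows "poly_time_decidable (shape_embedding_problem \<Sigma> \<kappa>)"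
proof -
  obtain ks where ks: "set ks = \<kappa> ` \<Sigma>"
    using assms(1) finite_list[of "\<kappa> ` \<Sigma>"] by auto
  show ?thesis
  proof (rule poly_time_decidable_loop_program)
    show "cmd_wf RefineC"
      by (simp add: RefineC_def CheckC_def AuctionC_def BidC_def BoundedE_def FitsE_def
          MandatoryE_def EdgeOkE_def)
    show "expr_wf (ResultE ks)"
      by (simp add: ResultE_def ValidGraphE_def MemberE_def expr_wf_LabelE)
    fix x
    let ?h = "run x (\<lambda>_. length x) RefineC (\<lambda>_ _. 0)"
    \<comment> \<open>Nothing is claimed about array 0 for invalid inputs; there the validity tests
      in \<open>ResultE\<close> alone produce the output 0.\<close>
    have "valid_input (\<kappa> ` \<Sigma>) x \<Longrightarrow> ?h 0 = refined x"
      by (rule run_RefineC) (simp add: valid_input_def)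
    then show "eval x ?h (\<lambda>_. length x) (ResultE ks) =
        (if x \<in> shape_embedding_problem \<Sigma> \<kappa> then 1 else 0)"
      using embeds_iff_refined[OF _ assms(2), of x]
      by (auto simp: eval_ResultE ks shape_embedding_problem_iff[OF assms(2)])
  qed
qed

end
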